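(* Let $\eta<\xi$, $I=[\eta,\xi]$, and let $f:I\to\mathbb{R}$ be such that $f''$ is continuous on $I$ and bounded away from $0$ there (one-sided derivatives at the endpoints). Suppose that $0<\theta<1$ and $f''\in\mathrm{Lip}_\theta(I)$, and let $\psi$ be an approximating function with $\psi(Q)\ge Q^{-\phi}$, where $\phi$ is a real number with $\phi\le\frac{1+\theta}{3-\theta}$. Then $$N_f(Q,\psi,I)\ll\psi(Q)Q^2,$$ where $$N_f(Q,\psi,I)=\mathrm{card}\{\mathbf p/q\in\mathbb{Q}^2 : q\le Q,\ p_1/q\in I,\ |f(p_1/q)-p_2/q|<\psi(Q)/Q\},$$ with $\mathbf p/q:=(p_1/q,p_2/q)$, $\mathbf p=(p_1,p_2)\in\mathbb{Z}^2$, $q\in\mathbb{N}$.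
   Context: An approximating function is a real, positive, decreasing function $\psi:\mathbb{R}^+\to\mathbb{R}^+$ with $\psi(t)\to0$ as $t\to\infty$. $g\in\mathrm{Lip}_\theta(I)$ means there is $C>0$ with $|g(x)-g(y)|\le C|x-y|^\theta$ for all $x,y\in I$. The implied constant is independent of $Q$. *)

theory Defs
  imports "HOL-Analysis.Analysis"
begin

text \<open>The set of positive reals is represented by restricting to arguments \<open>t > 0\<close>;
  ``decreasing'' is meant in the weak sense.\<close>

definition approximating_function :: "(real \<Rightarrow> real) \<Rightarrow> bool" where
  "approximating_function \<psi> \<longleftrightarrow>
     (\<forall>t>0. \<psi> t > 0) \<and> antimono_on {0<..} \<psi> \<and> (\<psi> \<longlongrightarrow> 0) at_top"

definition Lip :: "real \<Rightarrow> real set \<Rightarrow> (real \<Rightarrow> real) set" where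
  "Lip \<theta> S = {g. \<exists>C>0. \<forall>x\<in>S. \<forall>y\<in>S. \<bar>g x - g y\<bar> \<le> C * \<bar>x - y\<bar> powr \<theta>}"

text \<open>Elements are points of the plane, so a rational point that has several
  representations with denominator at most \<open>Q\<close> is counted once.\<close>

definition near_points ::
  "(real \<Rightarrow> real) \<Rightarrow> real \<Rightarrow> (real \<Rightarrow> real) \<Rightarrow> real set \<Rightarrow> (real \<times> real) set" where
  "near_points f Q \<psi> S =
     {(of_int p1 / of_nat q, of_int p2 / of_nat q) | (p1::int) (p2::int) (q::nat).
        1 \<le> q \<and> of_nat q \<le> Q \<and> of_int p1 / of_nat q \<in> S \<and>
        \<bar>f (of_int p1 / of_nat q) - of_int p2 / of_nat q\<bar> < \<psi> Q / Q}"

definition N_count ::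
  "(real \<Rightarrow> real) \<Rightarrow> real \<Rightarrow> (real \<Rightarrow> real) \<Rightarrow> real set \<Rightarrow> nat" where
  "N_count f Q \<psi> S = card (near_points f Q \<psi> S)"

text \<open>The cardinality above is never that of an infinite set (which \<open>card\<close> would send
  to \<open>0\<close>), without any assumption on \<open>f\<close>.\<close>

lemma finite_int_quotients_near:
  fixes q :: nat and u v :: real
  assumes "1 \<le> q"
  shows "finite {p::int. u \<le> of_int p / of_nat q \<and> of_int p / of_nat q \<le> v}"
proof (rule finite_subset)
  show "{p::int. u \<le> of_int p / of_nat q \<and> of_int p / of_nat q \<le> v}
          \<subseteq> {\<lceil>u * of_nat q\<rceil>..\<lfloor>v * of_nat q\<rfloor>}"
    using assms by (auto simp: ceiling_le_iff le_floor_iff field_simps)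
qed simp

lemma finite_near_points:
  assumes "bounded S"
  shows "finite (near_points f Q \<psi> S)"
proof -
  obtain a where a: "\<And>x. x \<in> S \<Longrightarrow> \<bar>x\<bar> \<le> a"
    using assms unfolding bounded_iff real_norm_def by blast
  define A where
    "A q = {p::int. - a \<le> of_int p / of_nat q \<and> of_int p / of_nat q \<le> a}" for q :: nat
  define B where
    "B q p1 = {p::int. f (of_int p1 / of_nat q) - \<psi> Q / Q \<le> of_int p / of_nat q \<and>
                       of_int p / of_nat q \<le> f (of_int p1 / of_nat q) + \<psi> Q / Q}"
    for q :: nat and p1 :: int
  define T where "T = (SIGMA q:{1..nat \<lfloor>Q\<rfloor>}. SIGMA p1:A q. B q p1)"
  have "finite T"
    unfolding T_def A_def B_def
    by (intro finite_SigmaI finite_atLeastAtMost finite_int_quotients_near) auto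
  moreover have "near_points f Q \<psi> S \<subseteq>
      (\<lambda>(q, p1, p2). (of_int p1 / of_nat q, of_int p2 / of_nat q)) ` T"
  proof
    fix z assume "z \<in> near_points f Q \<psi> S"
    then obtain p1 p2 :: int and q :: nat where
      z: "z = (of_int p1 / of_nat q, of_int p2 / of_nat q)" and
      q: "1 \<le> q" "of_nat q \<le> Q" and S: "of_int p1 / of_nat q \<in> S" and
      d: "\<bar>f (of_int p1 / of_nat q) - of_int p2 / of_nat q\<bar> < \<psi> Q / Q"
      unfolding near_points_def by blast
    have "q \<in> {1..nat \<lfloor>Q\<rfloor>}" using q by (simp add: le_nat_floor)
    moreover have "p1 \<in> A q" using a[OF S] unfolding A_def mem_Collect_eq by linarith
    moreover have "p2 \<in> B q p1" using d unfolding B_def mem_Collect_eq by linarith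
    ultimately have "(q, p1, p2) \<in> T" unfolding T_def by blast
    then show "z \<in> (\<lambda>(q, p1, p2). (of_int p1 / of_nat q, of_int p2 / of_nat q)) ` T"
      unfolding z by (rule rev_image_eqI) simp
  qed
  ultimately show ?thesis by (rule finite_surj)
qed

end

(* Write delta = psi Q.  Cut the interval into about delta Q^2 blocks so short that three near points
   in a block with distinct abscissae span a triangle of area < 1/(2 Q^3); as its area is a multiple of
   1/(2 q1 q2 q3), the points are collinear.  Blocks with at most two points are harmless, and every
   other block lies on a line y = s x - t.

   If h is the common denominator of s and t, distinct rational points on that line are at least h/Q^2
   apart, so a chord of length c near the curve carries O(Q^2 c/h) of them.  Around the chord there is a
   zone in which all near points lie on this line (again by integrality), so the zones of distinct lines
   are disjoint.  For a line crossing the curve steeply the zone is long enough to pay for its points.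
   For a nearly tangent line, (s, t) is a rational point of height h within O(1/(hQ)) of the dual curve,
   whose curvature is again bounded above and below.  So counting bounds for the dual curve give bounds
   for the curve: an exponent 1 + e on the critical scale delta = K/Q improves to 1 + e/(1 + e), hence e
   can be made arbitrarily small, and then the nearly tangent lines are negligible because
   (1 + theta)/(3 - theta) < 1. *)
theory Submission
  imports Defs
begin

section \<open>Denominators and separated sets\<close>

text \<open>The nearly tangent lines are the obstacle. Such a line of height h has a chord of length
  about sqrt(\<delta>/Q) but a zone of length only about 1/sqrt(h Q), so disjointness of zones
  bounds the points on these lines only by about Q^2 sqrt(\<delta>/h), which is too much when h is
  small against 1/\<delta>. Lines of height below a threshold A are therefore counted through the
  dual curve. A nearly tangent line of height about R <= Q misses the dual curve by O(1/(R Q)),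
  hence by O(1/R^2): this is the critical scale with R in place of Q, so the exponent has to be
  improved at that scale only. As the count is then applied to the dual of an arbitrary curve, its
  constants may depend on the curvature bounds a, b and the length l, but not on the function or the
  position of the interval. As points of tangency may lie outside the interval, functions are first
  extended to the whole line. A is left free in the counting: A = 1 starts the induction, A = Q^(1 -
  \<tau>) drives it, and A = 1/\<delta> gives the final bound.\<close>

definition rational_upto :: "real \<Rightarrow> real \<times> real \<Rightarrow> bool" where
  "rational_upto Q p \<longleftrightarrow>
     (\<exists>q::nat. 1 \<le> q \<and> real q \<le> Q \<and> real q * fst p \<in> \<int> \<and> real q * snd p \<in> \<int>)"

text \<open>The common denominator; a junk value unless both arguments are rational.\<close>

definition den :: "real \<Rightarrow> real \<Rightarrow> nat" where
  "den s t = (LEAST n. 0 < n \<and> real n * s \<in> \<int> \<and> real n * t \<in> \<int>)"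

text \<open>Fractions are traded for integrality of q x and q y. The arithmetic below mostly takes
  the form: a polynomial in such products is an integer, and an integer of absolute value below 1 is
  0.\<close>

lemma near_points_iff:
  "(x, y) \<in> near_points f Q \<psi> S \<longleftrightarrow>
     rational_upto Q (x, y) \<and> x \<in> S \<and> \<bar>f x - y\<bar> < \<psi> Q / Q"
proof
  assume "(x, y) \<in> near_points f Q \<psi> S"
  then obtain p1 p2 :: int and q :: nat where
    z: "x = of_int p1 / real q" "y = of_int p2 / real q" and
    q: "1 \<le> q" "real q \<le> Q" and r: "x \<in> S" "\<bar>f x - y\<bar> < \<psi> Q / Q"
    unfolding near_points_def by blast
  have "real q * x = of_int p1" "real q * y = of_int p2"
    using z q by auto
  then show "rational_upto Q (x, y) \<and> x \<in> S \<and> \<bar>f x - y\<bar> < \<psi> Q / Q"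
    using q r unfolding rational_upto_def by (metis Ints_of_int fst_conv snd_conv)
next
  assume a: "rational_upto Q (x, y) \<and> x \<in> S \<and> \<bar>f x - y\<bar> < \<psi> Q / Q"
  then obtain q :: nat and p1 p2 :: int where q: "1 \<le> q" "real q \<le> Q"
    and p: "real q * x = of_int p1" "real q * y = of_int p2"
    unfolding rational_upto_def by (auto elim!: Ints_cases)
  have "x = of_int p1 / real q" "y = of_int p2 / real q"
    using p q by (auto simp: field_simps)
  then show "(x, y) \<in> near_points f Q \<psi> S"
    using a q unfolding near_points_def by blast
qed

lemma
  assumes "0 < n" "real n * s \<in> \<int>" "real n * t \<in> \<int>"
  shows den_pos: "0 < den s t"
    and den_fst: "real (den s t) * s \<in> \<int>"
    and den_snd: "real (den s t) * t \<in> \<int>"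
    and den_le: "den s t \<le> n"
  using LeastI[of "\<lambda>n. 0 < n \<and> real n * s \<in> \<int> \<and> real n * t \<in> \<int>" n]
    Least_le[of "\<lambda>n. 0 < n \<and> real n * s \<in> \<int> \<and> real n * t \<in> \<int>" n] assms
  unfolding den_def by auto

text \<open>The integers that clear both denominators are closed under differences and multiples, so
  the remainder of D modulo the least positive one clears them too and must vanish.\<close>

lemma den_dvd:
  fixes D :: int
  assumes "D \<noteq> 0" "of_int D * s \<in> \<int>" "of_int D * t \<in> \<int>"
  shows "int (den s t) dvd D"
proof -
  have "real (nat \<bar>D\<bar>) * z \<in> \<int>" if "of_int D * z \<in> \<int>" for z :: real
    using that by (cases "D \<ge> 0") (auto simp: minus_in_Ints_iff)
  note n = this[OF assms(2)] this[OF assms(3)]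
  have n0: "0 < nat \<bar>D\<bar>" using assms by simp
  define h where "h = den s t"
  have h: "0 < h" "real h * s \<in> \<int>" "real h * t \<in> \<int>"
    unfolding h_def using den_pos[OF n0 n] den_fst[OF n0 n] den_snd[OF n0 n] by auto
  define r where "r = nat (D mod int h)"
  have r: "int r = D mod int h" "r < h" unfolding r_def using h(1) by (auto simp: nat_less_iff)
  have eq: "real r = of_int D - of_int (D div int h) * real h"
  proof -
    have "int r = D - (D div int h) * int h" by (simp add: r(1) minus_div_mult_eq_mod)
    then have "of_int (int r) = (of_int (D - (D div int h) * int h) :: real)" by (rule arg_cong)
    then show ?thesis by simp
  qed
  have rz: "real r * z \<in> \<int>" if "of_int D * z \<in> \<int>" "real h * z \<in> \<int>" for z
  proof -
    have "real r * z = of_int D * z - of_int (D div int h) * (real h * z)"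
      unfolding eq by (simp add: algebra_simps)
    then show ?thesis using that by (metis Ints_diff Ints_mult Ints_of_int)
  qed
  have "r = 0"
  proof (rule ccontr)
    assume "r \<noteq> 0"
    then have "den s t \<le> r" using den_le[of r s t] rz assms h by auto
    then show False using r(2) h_def by simp
  qed
  then show ?thesis using r(1) unfolding h_def by (simp add: dvd_eq_mod_eq_0)
qed

lemma den_le_abs:
  fixes D :: real
  assumes "D \<in> \<int>" "D \<noteq> 0" "D * s \<in> \<int>" "D * t \<in> \<int>"
  shows "real (den s t) \<le> \<bar>D\<bar>"
proof -
  obtain n :: int where n: "D = of_int n" using assms(1) by (auto elim: Ints_cases)
  have "int (den s t) dvd n" using den_dvd[of n s t] assms n by auto
  then have "int (den s t) \<le> \<bar>n\<bar>" using n assms(2)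
    by (metis dvd_imp_le_int abs_of_nat of_int_0)
  then show ?thesis unfolding n by (metis of_int_abs of_int_le_iff of_int_of_nat_eq)
qed

lemma gap_card:
  fixes E :: "real set"
  assumes "finite E" "E \<noteq> {}" and gap: "\<And>x y. x \<in> E \<Longrightarrow> y \<in> E \<Longrightarrow> x < y \<Longrightarrow> g \<le> y - x"
  shows "(real (card E) - 1) * g \<le> Max E - Min E"
  using assms
proof (induction E rule: finite_linorder_max_induct)
  case empty
  then show ?case by simp
next
  case (insert b A)
  show ?case
  proof (cases "A = {}")
    case True
    then show ?thesis by simp
  next
    case False
    have M: "Max A \<in> A" "Min A \<in> A" using False insert.hyps by auto
    have "(real (card A) - 1) * g \<le> Max A - Min A"
      using insert False by auto
    moreover have "g \<le> b - Max A" using insert M by auto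
    moreover have "Max (insert b A) = b" "Min (insert b A) = Min A"
    proof -
      have "Max A < b" "Min A < b" using M insert.hyps by auto
      then show "Max (insert b A) = b" "Min (insert b A) = Min A"
        using insert.hyps False by (auto simp del: Max_less_iff Min_less_iff)
    qed
    moreover have "card (insert b A) = Suc (card A)" using insert by auto
    ultimately show ?thesis by (simp add: algebra_simps)
  qed
qed

text \<open>Give i the interval of length w i / 2 centred at u i. If two of these met, their centres
  would be closer than (w i + w j) / 4, which is at most half of the larger weight, against
  \<open>sep\<close>. All of them lie in an interval of length l + 1. Separation is asked in terms
  of the larger weight because it will come from capture by the wider of two zones.\<close>

lemma sum_zones_le:
  fixes u w :: "'a \<Rightarrow> real"
  assumes fin: "finite I" and u: "\<And>i. i \<in> I \<Longrightarrow> u i \<in> {\<alpha>..\<alpha> + l}"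
    and w: "\<And>i. i \<in> I \<Longrightarrow> 0 < w i \<and> w i \<le> 1"
    and sep: "\<And>i j. i \<in> I \<Longrightarrow> j \<in> I \<Longrightarrow> i \<noteq> j \<Longrightarrow> w j \<le> w i \<Longrightarrow> w i / 2 \<le> \<bar>u i - u j\<bar>"
    and l: "0 \<le> l"
  shows "sum w I \<le> 2 * (l + 1)"
proof -
  define B where "B i = {u i - w i / 4<..<u i + w i / 4}" for i
  have len: "measure lborel (B i) = w i / 2" if "i \<in> I" for i
    using w[OF that] unfolding B_def by simp
  have disj: "disjoint_family_on B I"
    unfolding disjoint_family_on_def
  proof (intro ballI impI)
    fix i j assume ij: "i \<in> I" "j \<in> I" "i \<noteq> j"
    have "\<not> (z \<in> B i \<and> z \<in> B j)" for z
    proof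
      assume "z \<in> B i \<and> z \<in> B j"
      then have z: "\<bar>u i - u j\<bar> < w i / 4 + w j / 4" "\<bar>u j - u i\<bar> < w i / 4 + w j / 4"
        unfolding B_def by auto
      show False using sep[of i j] sep[of j i] ij z by (cases "w j \<le> w i") auto
    qed
    then show "B i \<inter> B j = {}" by blast
  qed
  have "(\<Sum>i\<in>I. w i / 2) = (\<Sum>i\<in>I. measure lborel (B i))"
    by (rule sum.cong) (simp_all add: len)
  also have "\<dots> = measure lborel (\<Union>i\<in>I. B i)"
  proof (rule measure_finite_Union[symmetric, OF fin _ disj])
    show "B ` I \<subseteq> sets lborel" unfolding B_def by auto
    show "emeasure lborel (B i) \<noteq> \<infinity>" if "i \<in> I" for i
      using w[OF that] unfolding B_def by simp
  qed
  also have "\<dots> \<le> measure lborel {\<alpha> - 1/2..\<alpha> + l + 1/2}"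
  proof (rule measure_mono_fmeasurable)
    show "(\<Union>i\<in>I. B i) \<subseteq> {\<alpha> - 1/2..\<alpha> + l + 1/2}"
    proof
      fix z assume "z \<in> (\<Union>i\<in>I. B i)"
      then obtain i where "i \<in> I" "z \<in> B i" by blast
      then show "z \<in> {\<alpha> - 1/2..\<alpha> + l + 1/2}" using u[of i] w[of i] unfolding B_def by auto
    qed
    show "(\<Union>i\<in>I. B i) \<in> sets lborel" unfolding B_def using fin by auto
    show "{\<alpha> - 1/2..\<alpha> + l + 1/2} \<in> fmeasurable lborel"
      by (intro fmeasurableI) (auto simp: l)
  qed
  also have "\<dots> = l + 1" using l by simp
  finally show ?thesis by (simp add: sum_divide_distrib[symmetric])
qed

section \<open>Functions with pinched second difference and their duals\<close>

text \<open>A derivative-free form of \<open>a \<le> f'' \<le> b\<close>, which survives gluing and passes to the dual function.\<close>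

definition pinched :: "real \<Rightarrow> real \<Rightarrow> (real \<Rightarrow> real) \<Rightarrow> (real \<Rightarrow> real) \<Rightarrow> bool" where
  "pinched a b f f' \<longleftrightarrow>
     (\<forall>u v. a / 2 * (v - u)\<^sup>2 \<le> f v - f u - f' u * (v - u) \<and>
            f v - f u - f' u * (v - u) \<le> b / 2 * (v - u)\<^sup>2)"

lemma
  assumes "pinched a b f f'"
  shows pinched_lower: "a / 2 * (v - u)\<^sup>2 \<le> f v - f u - f' u * (v - u)"
    and pinched_upper: "f v - f u - f' u * (v - u) \<le> b / 2 * (v - u)\<^sup>2"
  using assms unfolding pinched_def by blast+

text \<open>Adding the inequalities for (u, v) and for (v, u) eliminates f.\<close>

lemma
  assumes "pinched a b f f'"
  shows pinched_slope_lower: "a * (v - u)\<^sup>2 \<le> (f' v - f' u) * (v - u)"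
    and pinched_slope_upper: "(f' v - f' u) * (v - u) \<le> b * (v - u)\<^sup>2"
proof -
  have sq: "(u - v)\<^sup>2 = (v - u)\<^sup>2" by (rule power2_commute)
  have e: "(f' v - f' u) * (v - u) = (f v - f u - f' u * (v - u)) + (f u - f v - f' v * (u - v))"
    by (simp add: algebra_simps)
  show "a * (v - u)\<^sup>2 \<le> (f' v - f' u) * (v - u)"
    using pinched_lower[OF assms, of v u] pinched_lower[OF assms, of u v] e sq by simp
  show "(f' v - f' u) * (v - u) \<le> b * (v - u)\<^sup>2"
    using pinched_upper[OF assms, of v u] pinched_upper[OF assms, of u v] e sq by simp
qed

lemma
  assumes "pinched a b f f'" "0 < a"
  shows pinched_abs_slope_lower: "a * \<bar>v - u\<bar> \<le> \<bar>f' v - f' u\<bar>"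
    and pinched_abs_slope_upper: "\<bar>f' v - f' u\<bar> \<le> b * \<bar>v - u\<bar>"
    and pinched_strict_mono: "u < v \<Longrightarrow> f' u < f' v"
proof -
  have "a * \<bar>v - u\<bar> \<le> \<bar>f' v - f' u\<bar> \<and> \<bar>f' v - f' u\<bar> \<le> b * \<bar>v - u\<bar>"
  proof (cases "u = v")
    case False
    then have p: "0 < \<bar>v - u\<bar>" by simp
    have "0 \<le> a * (v - u)\<^sup>2" using assms by simp
    then have nn: "0 \<le> (f' v - f' u) * (v - u)" using pinched_slope_lower[OF assms(1), of v u] by simp
    have e: "(f' v - f' u) * (v - u) = \<bar>f' v - f' u\<bar> * \<bar>v - u\<bar>"
      using nn by (metis abs_mult abs_of_nonneg)
    have s: "(v - u)\<^sup>2 = \<bar>v - u\<bar> * \<bar>v - u\<bar>" by (simp add: power2_eq_square)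
    have "(a * \<bar>v - u\<bar>) * \<bar>v - u\<bar> \<le> \<bar>f' v - f' u\<bar> * \<bar>v - u\<bar>"
      using pinched_slope_lower[OF assms(1), of v u] e s by (simp add: mult.assoc)
    moreover have "\<bar>f' v - f' u\<bar> * \<bar>v - u\<bar> \<le> (b * \<bar>v - u\<bar>) * \<bar>v - u\<bar>"
      using pinched_slope_upper[OF assms(1), of v u] e s by (simp add: mult.assoc)
    ultimately show ?thesis using p by (metis mult_right_le_imp_le)
  qed simp
  then show "a * \<bar>v - u\<bar> \<le> \<bar>f' v - f' u\<bar>" "\<bar>f' v - f' u\<bar> \<le> b * \<bar>v - u\<bar>" by auto
  show "f' u < f' v" if "u < v"
  proof -
    have "0 < a * (v - u)\<^sup>2" using that assms by simp
    then have "0 < (f' v - f' u) * (v - u)" using pinched_slope_lower[OF assms(1), of v u] by simp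
    then show ?thesis using that by (simp add: zero_less_mult_iff)
  qed
qed

text \<open>f' is Lipschitz, hence continuous, and increases at rate at least a, so it reaches s
  within distance |s - f' 0| / a of 0.\<close>

lemma pinched_surj:
  assumes "pinched a b f f'" "0 < a"
  obtains x where "f' x = s"
proof -
  have b0: "0 \<le> b" using pinched_abs_slope_upper[OF assms, of 1 0] by simp
  have lip: "(max b 1)-lipschitz_on UNIV f'"
  proof (rule lipschitz_onI)
    show "dist (f' x) (f' y) \<le> max b 1 * dist x y" for x y
      using pinched_abs_slope_upper[OF assms, of x y]
      by (smt (verit) dist_real_def mult_right_mono zero_le_dist)
  qed simp
  then have cont: "continuous_on UNIV f'" by (rule lipschitz_on_continuous_on)
  define r where "r = \<bar>s - f' 0\<bar> / a"
  have r: "0 \<le> r" "a * r = \<bar>s - f' 0\<bar>" unfolding r_def using assms by auto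
  have "f' (- r) \<le> s"
  proof (cases "r = 0")
    case True then show ?thesis using r by simp
  next
    case False
    then have "f' (- r) < f' 0" using pinched_strict_mono[OF assms, of "- r" 0] r by simp
    then show ?thesis using pinched_abs_slope_lower[OF assms, of "- r" 0] r by simp
  qed
  moreover have "s \<le> f' r"
  proof (cases "r = 0")
    case True then show ?thesis using r by simp
  next
    case False
    then have "f' 0 < f' r" using pinched_strict_mono[OF assms, of 0 r] r by simp
    then show ?thesis using pinched_abs_slope_lower[OF assms, of r 0] r by simp
  qed
  ultimately obtain x where "f' x = s"
    using IVT'[of f' "- r" s r] r continuous_on_subset[OF cont] by auto
  then show thesis by (rule that)
qed

section \<open>The Legendre transform\<close>

definition dual_slope :: "(real \<Rightarrow> real) \<Rightarrow> real \<Rightarrow> real" where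
  "dual_slope f' s = (SOME x. f' x = s)"

text \<open>For pinched f with a > 0 this is the Legendre transform: y = s x - t is tangent to the
  graph of f exactly when t = \<open>dual f f' s\<close>, and \<open>dual_slope f'\<close>, the
  inverse of f', is the derivative of the transform.\<close>

definition dual :: "(real \<Rightarrow> real) \<Rightarrow> (real \<Rightarrow> real) \<Rightarrow> real \<Rightarrow> real" where
  "dual f f' s = s * dual_slope f' s - f (dual_slope f' s)"

lemma dual_slope:
  assumes "pinched a b f f'" "0 < a"
  shows "f' (dual_slope f' s) = s"
  unfolding dual_slope_def by (rule someI_ex) (metis pinched_surj[OF assms])

text \<open>With x, y the points of slope u, v, the Taylor remainder of the dual based at u equals
  the remainder of f based at y (identity \<open>e\<close>). The bounds on f' then exchange (x -
  y)^2 for (v - u)^2. The constants are cruder than 1/b and 1/a, but they depend on a and b alone,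
  which is what the induction needs.\<close>

lemma pinched_dual:
  assumes p: "pinched a b f f'" and a: "0 < a" and b: "0 < b"
  shows "pinched (a / b\<^sup>2) (b / a\<^sup>2) (dual f f') (dual_slope f')"
  unfolding pinched_def
proof (intro allI)
  fix u v
  define x y where "x = dual_slope f' u" and "y = dual_slope f' v"
  have xy: "f' x = u" "f' y = v" unfolding x_def y_def by (rule dual_slope[OF p a])+
  have e: "dual f f' v - dual f f' u - dual_slope f' u * (v - u) = f x - f y - f' y * (x - y)"
    unfolding dual_def x_def[symmetric] y_def[symmetric] xy by (simp add: algebra_simps)
  have l: "a\<^sup>2 * (x - y)\<^sup>2 \<le> (v - u)\<^sup>2"
  proof -
    have "(a * \<bar>y - x\<bar>)\<^sup>2 \<le> \<bar>f' y - f' x\<bar>\<^sup>2"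
      using pinched_abs_slope_lower[OF p a, of y x] a by (intro power_mono) auto
    then show ?thesis by (simp add: xy power_mult_distrib power2_commute)
  qed
  have r: "(v - u)\<^sup>2 \<le> b\<^sup>2 * (x - y)\<^sup>2"
  proof -
    have "\<bar>f' y - f' x\<bar>\<^sup>2 \<le> (b * \<bar>y - x\<bar>)\<^sup>2"
      using pinched_abs_slope_upper[OF p a, of y x] by (intro power_mono) auto
    then show ?thesis by (simp add: xy power_mult_distrib power2_commute)
  qed
  have "a / b\<^sup>2 / 2 * (v - u)\<^sup>2 \<le> a / 2 * (x - y)\<^sup>2"
    using mult_left_mono[OF r, of "a / 2 / b\<^sup>2"] a b by simp
  moreover have "b / 2 * (x - y)\<^sup>2 \<le> b / a\<^sup>2 / 2 * (v - u)\<^sup>2"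
    using mult_left_mono[OF l, of "b / 2 / a\<^sup>2"] a b by simp
  ultimately show "a / b\<^sup>2 / 2 * (v - u)\<^sup>2 \<le> dual f f' v - dual f f' u - dual_slope f' u * (v - u) \<and>
    dual f f' v - dual f f' u - dual_slope f' u * (v - u) \<le> b / a\<^sup>2 / 2 * (v - u)\<^sup>2"
    unfolding e using pinched_lower[OF p, where u=y and v=x] pinched_upper[OF p, where u=y and v=x] by linarith
qed

section \<open>Extension from an interval to the whole line\<close>

definition pinched_on :: "real set \<Rightarrow> real \<Rightarrow> real \<Rightarrow> (real \<Rightarrow> real) \<Rightarrow> (real \<Rightarrow> real) \<Rightarrow> bool" where
  "pinched_on S a b f f' \<longleftrightarrow>
     (\<forall>u\<in>S. \<forall>v\<in>S. a / 2 * (v - u)\<^sup>2 \<le> f v - f u - f' u * (v - u) \<and>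
            f v - f u - f' u * (v - u) \<le> b / 2 * (v - u)\<^sup>2)"

lemma pinched_on_slope:
  assumes "pinched_on S a b f f'" "u \<in> S" "v \<in> S" "u \<le> v"
  shows "a * (v - u) \<le> f' v - f' u \<and> f' v - f' u \<le> b * (v - u)"
proof (cases "u = v")
  case False
  have sq: "(u - v)\<^sup>2 = (v - u)\<^sup>2" by (rule power2_commute)
  have e: "(f' v - f' u) * (v - u) = (f v - f u - f' u * (v - u)) + (f u - f v - f' v * (u - v))"
    by (simp add: algebra_simps)
  have "a / 2 * (v - u)\<^sup>2 + a / 2 * (u - v)\<^sup>2 \<le> (f' v - f' u) * (v - u)"
    "(f' v - f' u) * (v - u) \<le> b / 2 * (v - u)\<^sup>2 + b / 2 * (u - v)\<^sup>2"
    unfolding e using assms unfolding pinched_on_def by (smt (verit))+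
  then have "a * (v - u)\<^sup>2 \<le> (f' v - f' u) * (v - u)" "(f' v - f' u) * (v - u) \<le> b * (v - u)\<^sup>2"
    unfolding sq by simp_all
  then have "(a * (v - u)) * (v - u) \<le> (f' v - f' u) * (v - u)"
    "(f' v - f' u) * (v - u) \<le> (b * (v - u)) * (v - u)"
    by (simp_all add: power2_eq_square mult.assoc)
  moreover have "0 < v - u" using False assms by simp
  ultimately show ?thesis by (metis mult_right_le_imp_le)
qed simp

text \<open>Split the step from u to v at p. The remainder of f and the form c/2 (v - u)^2 split
  alike, into two one-sided parts and a cross term: (f' p - f' u) (v - p) against c (p - u) (v - p).
  The slope bounds on the side of u compare the cross terms.\<close>

lemma pinched_on_glue:
  assumes S: "pinched_on S a b f f'" and T: "pinched_on T a b f f'"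
    and p: "p \<in> S" "p \<in> T" and S_le: "\<And>x. x \<in> S \<Longrightarrow> x \<le> p" and T_ge: "\<And>x. x \<in> T \<Longrightarrow> p \<le> x"
  shows "pinched_on (S \<union> T) a b f f'"
proof -
  have key: "c / 2 * (v - u)\<^sup>2 = c / 2 * (v - p)\<^sup>2 + c / 2 * (p - u)\<^sup>2 + c * (p - u) * (v - p)" for c u v :: real
    by (simp add: field_simps power2_eq_square)
  have eq: "f v - f u - f' u * (v - u) =
      (f v - f p - f' p * (v - p)) + (f p - f u - f' u * (p - u)) + (f' p - f' u) * (v - p)" for u v
    by (simp add: algebra_simps)
  have st: "a / 2 * (v - u)\<^sup>2 \<le> f v - f u - f' u * (v - u) \<and>
            f v - f u - f' u * (v - u) \<le> b / 2 * (v - u)\<^sup>2" if uv: "u \<in> S" "v \<in> T" for u v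
  proof -
    have "a * (p - u) \<le> f' p - f' u \<and> f' p - f' u \<le> b * (p - u)"
      using pinched_on_slope[OF S uv(1) p(1)] S_le uv by auto
    then have "a * (p - u) * (v - p) \<le> (f' p - f' u) * (v - p) \<and>
        (f' p - f' u) * (v - p) \<le> b * (p - u) * (v - p)"
      using T_ge[OF uv(2)] by (auto intro!: mult_right_mono)
    moreover have "a / 2 * (v - p)\<^sup>2 \<le> f v - f p - f' p * (v - p) \<and> f v - f p - f' p * (v - p) \<le> b / 2 * (v - p)\<^sup>2"
      using T uv p unfolding pinched_on_def by blast
    moreover have "a / 2 * (p - u)\<^sup>2 \<le> f p - f u - f' u * (p - u) \<and> f p - f u - f' u * (p - u) \<le> b / 2 * (p - u)\<^sup>2"
      using S uv p unfolding pinched_on_def by blast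
    ultimately show ?thesis using eq[of v u] key[of a v u] key[of b v u] by linarith
  qed
  have ts: "a / 2 * (v - u)\<^sup>2 \<le> f v - f u - f' u * (v - u) \<and>
            f v - f u - f' u * (v - u) \<le> b / 2 * (v - u)\<^sup>2" if uv: "v \<in> S" "u \<in> T" for u v
  proof -
    have "a * (u - p) \<le> f' u - f' p \<and> f' u - f' p \<le> b * (u - p)"
      using pinched_on_slope[OF T p(2) uv(2)] T_ge uv by auto
    then have "a * (u - p) * (p - v) \<le> (f' u - f' p) * (p - v) \<and>
        (f' u - f' p) * (p - v) \<le> b * (u - p) * (p - v)"
      using S_le[OF uv(1)] by (auto intro!: mult_right_mono)
    moreover have "a * (u - p) * (p - v) = a * (p - u) * (v - p)" "b * (u - p) * (p - v) = b * (p - u) * (v - p)"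
      "(f' u - f' p) * (p - v) = (f' p - f' u) * (v - p)"
      by (simp_all add: algebra_simps)
    moreover have "a / 2 * (v - p)\<^sup>2 \<le> f v - f p - f' p * (v - p) \<and> f v - f p - f' p * (v - p) \<le> b / 2 * (v - p)\<^sup>2"
      using S uv p unfolding pinched_on_def by blast
    moreover have "a / 2 * (p - u)\<^sup>2 \<le> f p - f u - f' u * (p - u) \<and> f p - f u - f' u * (p - u) \<le> b / 2 * (p - u)\<^sup>2"
      using T uv p unfolding pinched_on_def by blast
    ultimately show ?thesis using eq[of v u] key[of a v u] key[of b v u] by linarith
  qed
  show ?thesis
    using S T st ts unfolding pinched_on_def by blast
qed

lemma pinched_on_interval:
  assumes f: "\<And>x. x \<in> {\<eta>..\<xi>} \<Longrightarrow> (f has_real_derivative f' x) (at x within {\<eta>..\<xi>})"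
    and f': "\<And>x. x \<in> {\<eta>..\<xi>} \<Longrightarrow> (f' has_real_derivative f'' x) (at x within {\<eta>..\<xi>})"
    and bnd: "\<And>x. x \<in> {\<eta>..\<xi>} \<Longrightarrow> a \<le> f'' x \<and> f'' x \<le> b"
  shows "pinched_on {\<eta>..\<xi>} a b f f'"
proof -
  have mvt: "\<exists>z\<in>{\<eta>..\<xi>}. (u \<le> z \<and> z \<le> v \<or> v \<le> z \<and> z \<le> u) \<and> g v - g u = g' z * (v - u)"
    if g: "\<And>x. x \<in> {\<eta>..\<xi>} \<Longrightarrow> (g has_real_derivative g' x) (at x within {\<eta>..\<xi>})"
      and uv: "u \<in> {\<eta>..\<xi>}" "v \<in> {\<eta>..\<xi>}" for g g' :: "real \<Rightarrow> real" and u v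
  proof -
    have one: "\<exists>z\<in>{\<eta>..\<xi>}. u \<le> z \<and> z \<le> v \<and> g v - g u = g' z * (v - u)"
      if uv: "u \<in> {\<eta>..\<xi>}" "v \<in> {\<eta>..\<xi>}" "u < v" for u v
    proof -
      have "\<exists>z\<in>{u<..<v}. g v - g u = (*) (g' z) (v - u)"
      proof (rule mvt_simple[OF uv(3)])
        fix x assume "u \<le> x" "x \<le> v"
        then have "x \<in> {\<eta>..\<xi>}" "{u..v} \<subseteq> {\<eta>..\<xi>}" using uv by auto
        then show "(g has_derivative (*) (g' x)) (at x within {u..v})"
          using g has_field_derivative_subset unfolding has_field_derivative_def[symmetric] by blast
      qed
      then obtain z where "z \<in> {u<..<v}" "g v - g u = g' z * (v - u)" by auto
      then show ?thesis using uv by (intro bexI[of _ z]) auto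
    qed
    consider "u < v" | "v < u" | "u = v" by linarith
    then show ?thesis
    proof cases
      case 1 then show ?thesis using one[OF uv] by blast
    next
      case 2
      then obtain z where "z \<in> {\<eta>..\<xi>}" "v \<le> z" "z \<le> u" "g u - g v = g' z * (u - v)"
        using one[OF uv(2,1)] by blast
      then show ?thesis by (intro bexI[of _ z]) (auto simp: algebra_simps)
    next
      case 3 then show ?thesis using uv by auto
    qed
  qed
  have slope: "a * (z - u)\<^sup>2 \<le> (f' z - f' u) * (z - u) \<and> (f' z - f' u) * (z - u) \<le> b * (z - u)\<^sup>2"
    if zu: "z \<in> {\<eta>..\<xi>}" "u \<in> {\<eta>..\<xi>}" for z u
  proof -
    obtain y where y: "y \<in> {\<eta>..\<xi>}" "f' z - f' u = f'' y * (z - u)"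
      using mvt[OF f' zu(2,1)] by blast
    show ?thesis using bnd[OF y(1)] unfolding y(2)
      by (auto simp: power2_eq_square mult.assoc intro!: mult_right_mono)
  qed
  \<comment> \<open>The sign m = 1 or m = -1 serves the lower and the upper bound at once: by
    \<open>c\<close>, the derivative of m g at z never has the sign opposite to z - u, so m g, which
    vanishes at u, is nonnegative.\<close>
  have quad: "0 \<le> m * (f v - f u - f' u * (v - u) - c / 2 * (v - u)\<^sup>2)"
    if c: "\<And>z. z \<in> {\<eta>..\<xi>} \<Longrightarrow> 0 \<le> m * ((f' z - f' u) * (z - u) - c * (z - u)\<^sup>2)"
      and uv: "u \<in> {\<eta>..\<xi>}" "v \<in> {\<eta>..\<xi>}" for u v c m
  proof -
    define g where "g x = f x - f u - f' u * (x - u) - c / 2 * (x - u)\<^sup>2" for x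
    have g: "(g has_real_derivative (f' x - f' u - c * (x - u))) (at x within {\<eta>..\<xi>})"
      if "x \<in> {\<eta>..\<xi>}" for x
      unfolding g_def by (rule derivative_eq_intros f[OF that] refl | simp)+
    obtain z where z: "z \<in> {\<eta>..\<xi>}" "u \<le> z \<and> z \<le> v \<or> v \<le> z \<and> z \<le> u"
      "g v - g u = (f' z - f' u - c * (z - u)) * (v - u)"
      using mvt[OF g uv] by blast
    have "g v = (f' z - f' u - c * (z - u)) * (v - u)" using z unfolding g_def by simp
    moreover have "0 \<le> m * (f' z - f' u - c * (z - u)) * (v - u)"
    proof (cases "z = u")
      case False
      have "0 \<le> (m * (f' z - f' u - c * (z - u))) * (z - u)"
        using c[OF z(1)] by (simp add: algebra_simps power2_eq_square)
      then show ?thesis using z(2) False by (auto simp: zero_le_mult_iff)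
    qed simp
    ultimately show ?thesis unfolding g_def by (simp add: mult.assoc)
  qed
  show ?thesis unfolding pinched_on_def
    using quad[of 1 _ a] quad[of "-1" _ b] slope by fastforce
qed

text \<open>Beyond each endpoint, f continues as the parabola with the value and slope of f there
  and second derivative a; k x is the point of the interval closest to x. The dual is then defined
  for every slope, with the same a and b.\<close>

lemma pinched_extension:
  assumes g: "pinched_on {\<eta>..\<xi>} a b f f'" and le: "\<eta> \<le> \<xi>" "a \<le> b"
  shows "\<exists>h h'. pinched a b h h' \<and> (\<forall>x\<in>{\<eta>..\<xi>}. h x = f x)"
proof -
  define k where "k x = max \<eta> (min \<xi> x)" for x
  define h where "h x = f (k x) + f' (k x) * (x - k x) + a / 2 * (x - k x)\<^sup>2" for x
  define h' where "h' x = f' (k x) + a * (x - k x)" for x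
  have km: "k x = x" if "x \<in> {\<eta>..\<xi>}" for x using that unfolding k_def by auto
  have kl: "k x = \<eta>" if "x \<in> {..\<eta>}" for x using that le unfolding k_def by auto
  have kr: "k x = \<xi>" if "x \<in> {\<xi>..}" for x using that le unfolding k_def by auto
  have flat: "pinched_on S a b h h'" if "\<And>x. x \<in> S \<Longrightarrow> k x = p" for S p
  proof -
    have e: "h v - h u - h' u * (v - u) = a / 2 * (v - u)\<^sup>2" if "u \<in> S" "v \<in> S" for u v
      unfolding h_def h'_def \<open>\<And>x. x \<in> S \<Longrightarrow> k x = p\<close>[OF that(1)] \<open>\<And>x. x \<in> S \<Longrightarrow> k x = p\<close>[OF that(2)]
      by (simp add: field_simps power2_eq_square)
    show ?thesis unfolding pinched_on_def
      using le by (auto simp: e intro!: mult_right_mono)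
  qed
  have mid: "pinched_on {\<eta>..\<xi>} a b h h'"
    using g unfolding pinched_on_def h_def h'_def by (simp add: km)
  have "pinched_on ({..\<eta>} \<union> {\<eta>..\<xi>}) a b h h'"
    by (rule pinched_on_glue[OF flat[OF kl] mid, where p = \<eta>]) (auto simp: le)
  then have "pinched_on (({..\<eta>} \<union> {\<eta>..\<xi>}) \<union> {\<xi>..}) a b h h'"
    by (rule pinched_on_glue[OF _ flat[OF kr], where p = \<xi>]) (use le in auto)
  moreover have "({..\<eta>} \<union> {\<eta>..\<xi>}) \<union> {\<xi>..} = UNIV" by auto
  ultimately have "pinched a b h h'" unfolding pinched_def pinched_on_def by auto
  moreover have "\<forall>x\<in>{\<eta>..\<xi>}. h x = f x" by (simp add: h_def km)
  ultimately show ?thesis by blast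
qed

section \<open>Lines carrying many near points\<close>

text \<open>Up to signs, (D, D s, D t) is the cross product of the integer vectors (q, q x, q y) of
  the two points, where D = q q' (x - x'). Hence |D| bounds the height of the line.\<close>

lemma line_gap:
  assumes "rational_upto Q (x, s * x - t)" "rational_upto Q (x', s * x' - t)" "x \<noteq> x'"
  shows "\<exists>n>0. real n * s \<in> \<int> \<and> real n * t \<in> \<int>"
    and "real (den s t) \<le> Q\<^sup>2 * \<bar>x - x'\<bar>"
proof -
  obtain q q' :: nat where q: "1 \<le> q" "real q \<le> Q" "real q * x \<in> \<int>" "real q * (s * x - t) \<in> \<int>"
    and q': "1 \<le> q'" "real q' \<le> Q" "real q' * x' \<in> \<int>" "real q' * (s * x' - t) \<in> \<int>"
    using assms unfolding rational_upto_def by auto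
  define D where "D = real q * real q' * (x - x')"
  have "D = real q' * (real q * x) - real q * (real q' * x')"
    unfolding D_def by (simp add: algebra_simps)
  then have D: "D \<in> \<int>" using q(3) q'(3) by simp
  have "D * s = real q' * (real q * (s * x - t)) - real q * (real q' * (s * x' - t))"
    unfolding D_def by (simp add: algebra_simps)
  then have Ds: "D * s \<in> \<int>" using q(4) q'(4) by simp
  have "D * t = (real q' * x') * (real q * (s * x - t)) - (real q * x) * (real q' * (s * x' - t))"
    unfolding D_def by (simp add: algebra_simps)
  then have Dt: "D * t \<in> \<int>" using q q' by (metis Ints_diff Ints_mult)
  have D0: "D \<noteq> 0" unfolding D_def using q q' assms(3) by simp
  obtain m :: int where m: "D = of_int m" using D by (auto elim: Ints_cases)
  have "real (nat \<bar>m\<bar>) * z \<in> \<int>" if "D * z \<in> \<int>" for z :: real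
    using that unfolding m by (cases "m \<ge> 0") (auto simp: minus_in_Ints_iff)
  then show "\<exists>n>0. real n * s \<in> \<int> \<and> real n * t \<in> \<int>"
    using Ds Dt D0 m by (intro exI[of _ "nat \<bar>m\<bar>"]) auto
  have "real (den s t) \<le> \<bar>D\<bar>" by (rule den_le_abs[OF D D0 Ds Dt])
  also have "\<dots> = (real q * real q') * \<bar>x - x'\<bar>" unfolding D_def by (simp add: abs_mult)
  also have "\<dots> \<le> Q\<^sup>2 * \<bar>x - x'\<bar>"
    unfolding power2_eq_square using q q' by (intro mult_right_mono mult_mono) auto
  finally show "real (den s t) \<le> Q\<^sup>2 * \<bar>x - x'\<bar>" .
qed

text \<open>A point of denominator q off the line differs from it vertically by a nonzero multiple
  of 1/(h q), hence by at least 1/(h Q).\<close>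

lemma on_line:
  assumes "rational_upto Q (x, y)" and h: "real h * s \<in> \<int>" "real h * t \<in> \<int>" "0 < h"
    and small: "real h * Q * \<bar>y - (s * x - t)\<bar> < 1"
  shows "y = s * x - t"
proof -
  obtain q :: nat where q: "1 \<le> q" "real q \<le> Q" "real q * x \<in> \<int>" "real q * y \<in> \<int>"
    using assms unfolding rational_upto_def by auto
  define z where "z = real h * real q * (y - (s * x - t))"
  have "z = real h * (real q * y) - (real h * s) * (real q * x) + real q * (real h * t)"
    unfolding z_def by (simp add: algebra_simps)
  then have zi: "z \<in> \<int>" using q h by (metis Ints_add Ints_diff Ints_mult Ints_of_nat)
  have "\<bar>z\<bar> = real h * real q * \<bar>y - (s * x - t)\<bar>" unfolding z_def by (simp add: abs_mult)
  also have "\<dots> \<le> real h * Q * \<bar>y - (s * x - t)\<bar>"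
    using q by (intro mult_right_mono mult_left_mono) auto
  finally have "\<bar>z\<bar> < 1" using small by simp
  then have "z = 0" using zi Ints_nonzero_abs_ge1 by force
  then show ?thesis using h q unfolding z_def by simp
qed

lemma collinear_triple:
  assumes r: "rational_upto Q (x1, y1)" "rational_upto Q (x2, y2)" "rational_upto Q (x3, y3)"
    and small: "Q ^ 3 * \<bar>(x2 - x1) * (y3 - y1) - (x3 - x1) * (y2 - y1)\<bar> < 1"
  shows "(x2 - x1) * (y3 - y1) = (x3 - x1) * (y2 - y1)"
proof -
  obtain q1 q2 q3 :: nat where
    q1: "1 \<le> q1" "real q1 \<le> Q" "real q1 * x1 \<in> \<int>" "real q1 * y1 \<in> \<int>" and
    q2: "1 \<le> q2" "real q2 \<le> Q" "real q2 * x2 \<in> \<int>" "real q2 * y2 \<in> \<int>" and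
    q3: "1 \<le> q3" "real q3 \<le> Q" "real q3 * x3 \<in> \<int>" "real q3 * y3 \<in> \<int>"
    using r unfolding rational_upto_def by auto
  let ?D = "(x2 - x1) * (y3 - y1) - (x3 - x1) * (y2 - y1)"
  define z where "z = real q1 * real q2 * real q3 * ?D"
  have "z = real q1 * ((real q2 * x2) * (real q3 * y3) - (real q3 * x3) * (real q2 * y2))
      - (real q1 * x1) * (real q2 * (real q3 * y3) - real q3 * (real q2 * y2))
      + (real q1 * y1) * (real q2 * (real q3 * x3) - real q3 * (real q2 * x2))"
    unfolding z_def by (simp add: algebra_simps)
  then have zi: "z \<in> \<int>" using q1 q2 q3 by (metis Ints_add Ints_diff Ints_mult Ints_of_nat)
  have "\<bar>z\<bar> = (real q1 * real q2 * real q3) * \<bar>?D\<bar>" unfolding z_def by (simp add: abs_mult)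
  also have "\<dots> \<le> Q ^ 3 * \<bar>?D\<bar>"
    unfolding power3_eq_cube using q1 q2 q3 by (intro mult_right_mono mult_mono) auto
  finally have "\<bar>z\<bar> < 1" using small by simp
  then have "z = 0" using zi Ints_nonzero_abs_ge1 by force
  then show ?thesis using q1 q2 q3 unfolding z_def by simp
qed

text \<open>These two constants are small enough for the integrality arguments of \<open>zone_on_line\<close> and \<open>block_on_line\<close>, and for chords to be
  at most half as long as their zones.\<close>

definition zone_const :: "real \<Rightarrow> real" where
  "zone_const b = min 1 (1 / (4 * b))"

definition block_const :: "real \<Rightarrow> real \<Rightarrow> real" where
  "block_const a b = min (1 / 8) ((zone_const b)\<^sup>2 * a / 16)"

text \<open>\<delta> is the value of \<psi> at a single Q. The last assumption makes the block
  length \<kappa> / (Q^2 \<delta>) at most \<kappa> / Q, so that curvature contributes at most b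
  \<kappa> / Q^3 to the determinants in \<open>block_on_line\<close>.\<close>

locale near_curve =
  fixes f f' :: "real \<Rightarrow> real" and a b \<alpha> l Q \<delta> :: real
  assumes pinched: "pinched a b f f'" and a_pos: "0 < a" and a_le_b: "a \<le> b"
    and l_nonneg: "0 \<le> l" and Q_ge_1: "1 \<le> Q" and \<delta>Q_ge_1: "1 \<le> \<delta> * Q"
begin

definition P :: "(real \<times> real) set" where
  "P = near_points f Q (\<lambda>_. \<delta>) {\<alpha>..\<alpha> + l}"

definition E :: "real \<Rightarrow> real \<Rightarrow> real set" where
  "E s t = {x. (x, s * x - t) \<in> P}"

abbreviation "k \<equiv> zone_const b"
abbreviation "\<kappa> \<equiv> block_const a b"

lemma mem_P: "(x, y) \<in> P \<longleftrightarrow> rational_upto Q (x, y) \<and> x \<in> {\<alpha>..\<alpha> + l} \<and> \<bar>f x - y\<bar> < \<delta> / Q"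
  unfolding P_def near_points_iff by simp

lemma finite_P: "finite P"
  unfolding P_def by (rule finite_near_points) simp

lemma b_pos: "0 < b" using a_pos a_le_b by simp

lemma Q_pos: "0 < Q" using Q_ge_1 by simp

lemma \<delta>_pos: "0 < \<delta>"
  using \<delta>Q_ge_1 Q_pos zero_less_mult_pos2[of \<delta> Q] by simp

lemma k_pos: "0 < k" and k_le_1: "k \<le> 1" and kb_le: "b * k \<le> 1 / 4"
proof -
  show "0 < k" "k \<le> 1" unfolding zone_const_def using b_pos by auto
  have "b * k \<le> b * (1 / (4 * b))"
    unfolding zone_const_def using b_pos by (intro mult_left_mono) auto
  then show "b * k \<le> 1 / 4" using b_pos by simp
qed

lemma \<kappa>_pos: "0 < \<kappa>" and \<kappa>_le: "\<kappa> \<le> 1 / 8" and \<kappa>_le_zone: "\<kappa> \<le> k\<^sup>2 * a / 16"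
  unfolding block_const_def using k_pos a_pos by auto

lemma b\<kappa>_le: "b * \<kappa> \<le> 1 / 64"
proof -
  have "b * \<kappa> \<le> b * (k\<^sup>2 * a / 16)" using \<kappa>_le_zone b_pos by (intro mult_left_mono) auto
  also have "\<dots> = (b * k) * (k * a) / 16" by (simp add: power2_eq_square)
  also have "\<dots> \<le> (1/4) * (k * b) / 16"
    using kb_le k_pos a_pos a_le_b by (intro divide_right_mono mult_mono mult_left_mono) auto
  also have "\<dots> \<le> 1 / 64" using kb_le by (simp add: mult.commute)
  finally show ?thesis .
qed

lemma finite_E: "finite (E s t)"
proof -
  have "E s t \<subseteq> fst ` P" unfolding E_def by force
  then show ?thesis using finite_P finite_surj by blast
qed

lemma E_near:
  assumes "x \<in> E s t"
  shows "\<bar>f x - (s * x - t)\<bar> < \<delta> / Q" "rational_upto Q (x, s * x - t)" "x \<in> {\<alpha>..\<alpha> + l}"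
  using assms unfolding E_def mem_Collect_eq mem_P by auto

lemma E_gap:
  assumes "x \<in> E s t" "x' \<in> E s t" "x \<noteq> x'"
  shows "0 < den s t" "real (den s t) * s \<in> \<int>" "real (den s t) * t \<in> \<int>"
    "real (den s t) \<le> Q\<^sup>2 * \<bar>x - x'\<bar>"
proof -
  note r = E_near(2)[OF assms(1)] E_near(2)[OF assms(2)] assms(3)
  obtain n where n: "n > 0" "real n * s \<in> \<int>" "real n * t \<in> \<int>" using line_gap(1)[OF r] by auto
  show "0 < den s t" "real (den s t) * s \<in> \<int>" "real (den s t) * t \<in> \<int>"
    using den_pos[OF n] den_fst[OF n] den_snd[OF n] by auto
  show "real (den s t) \<le> Q\<^sup>2 * \<bar>x - x'\<bar>" by (rule line_gap(2)[OF r])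
qed

lemma gap_card_E:
  assumes S: "S \<subseteq> E s t" "2 \<le> card S"
  shows "(real (card S) - 1) * (real (den s t) / Q\<^sup>2) \<le> Max S - Min S"
    and "Max S \<in> S" "Min S \<in> S" "Min S < Max S"
proof -
  have fin: "finite S" using S finite_E finite_subset by blast
  have ne: "S \<noteq> {}" using S by auto
  show "(real (card S) - 1) * (real (den s t) / Q\<^sup>2) \<le> Max S - Min S"
  proof (rule gap_card[OF fin ne])
    fix x y assume "x \<in> S" "y \<in> S" "x < y"
    then have "real (den s t) \<le> Q\<^sup>2 * \<bar>y - x\<bar>" using E_gap(4)[of y s t x] S by auto
    then show "real (den s t) / Q\<^sup>2 \<le> y - x"
      using Q_pos \<open>x < y\<close> by (simp add: field_simps)
  qed
  show M: "Max S \<in> S" "Min S \<in> S" using fin ne by auto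
  show "Min S < Max S"
  proof (rule ccontr)
    assume "\<not> Min S < Max S"
    then have "x = Max S" if "x \<in> S" for x
      using Max_ge[OF fin that] Min_le[OF fin that] by linarith
    then have "S \<subseteq> {Max S}" by blast
    then have "card S \<le> 1" using card_mono[of "{Max S}" S] by simp
    then show False using S by simp
  qed
qed

text \<open>The better populated side of the point of tangency is kept; this loses a factor two.\<close>

lemma line_end:
  assumes "3 \<le> card (E s t)"
  obtains u v where "u \<in> E s t" "v \<in> E s t" "u \<noteq> v" "0 \<le> (v - u) * (u - x1)"
    "real (card (E s t)) \<le> 4 * Q\<^sup>2 * \<bar>v - u\<bar> / real (den s t)"
proof -
  define R L where "R = {x \<in> E s t. x1 \<le> x}" and "L = {x \<in> E s t. x \<le> x1}"
  have "E s t = R \<union> L" unfolding R_def L_def by auto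
  then have c: "card (E s t) \<le> card R + card L" by (metis card_Un_le)
  have sub: "R \<subseteq> E s t" "L \<subseteq> E s t" unfolding R_def L_def by auto
  have main: "real (card (E s t)) \<le> 4 * Q\<^sup>2 * (Max S - Min S) / real (den s t)"
    if S: "S \<subseteq> E s t" "card (E s t) \<le> 2 * card S" for S
  proof -
    have c2: "2 \<le> card S" using S assms by simp
    note g = gap_card_E[OF S(1) c2]
    have d: "0 < den s t" using E_gap(1)[of "Max S" s t "Min S"] g S by auto
    have "real (card (E s t)) \<le> 2 * real (card S)" using S(2) by linarith
    \<comment> \<open>As \<open>card S\<close> is at least 2, it is at most twice the number of
      gaps.\<close>
    also have "\<dots> \<le> 4 * (real (card S) - 1)" using c2 by simp
    also have "\<dots> \<le> 4 * (Q\<^sup>2 * (Max S - Min S) / real (den s t))"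
      using g(1) d Q_pos by (simp add: field_simps)
    finally show ?thesis by simp
  qed
  consider "card (E s t) \<le> 2 * card R" | "card (E s t) \<le> 2 * card L" using c by linarith
  then show thesis
  proof cases
    case 1
    have c2: "2 \<le> card R" using 1 assms by simp
    note g = gap_card_E[OF sub(1) c2]
    show thesis
    proof (rule that[of "Min R" "Max R"])
      have "x1 \<le> Min R" using g(3) unfolding R_def by simp
      then show "0 \<le> (Max R - Min R) * (Min R - x1)" using g(4) by simp
    qed (use g sub main[OF sub(1) 1] in auto)
  next
    case 2
    have c2: "2 \<le> card L" using 2 assms by simp
    note g = gap_card_E[OF sub(2) c2]
    show thesis
    proof (rule that[of "Max L" "Min L"])
      have "Max L \<le> x1" using g(2) unfolding L_def by simp
      then show "0 \<le> (Min L - Max L) * (Max L - x1)" using g(4) by (simp add: mult_nonpos_nonpos)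
    qed (use g sub main[OF sub(2) 2] in auto)
  qed
qed

text \<open>The step from u to v leads away from the point of tangency x1, so in the expansion at u
  of f minus the line, the slope term and the quadratic term are both nonnegative. Their sum is at
  most 2 \<delta> / Q, as both ends lie within \<delta> / Q of the line; each term alone gives one
  of the bounds.\<close>

lemma line_end_bounds:
  assumes uv: "u \<in> E s t" "v \<in> E s t" "0 \<le> (v - u) * (u - x1)" and x1: "f' x1 = s"
  shows "\<bar>u - x1\<bar> * \<bar>v - u\<bar> \<le> 2 * \<delta> / (a * Q)" "\<bar>v - u\<bar>\<^sup>2 \<le> 4 * \<delta> / (a * Q)"
proof -
  have nn: "a * (\<bar>u - x1\<bar> * \<bar>v - u\<bar>) \<le> (f' u - s) * (v - u)"
  proof (cases "u = x1")
    case False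
    have p: "0 < (u - x1)\<^sup>2" using False by simp
    have "a * (u - x1)\<^sup>2 * ((v - u) * (u - x1)) \<le> ((f' u - s) * (u - x1)) * ((v - u) * (u - x1))"
      using pinched_slope_lower[OF pinched, where v=u and u=x1] uv(3) x1 by (intro mult_right_mono) auto
    then have "(a * ((v - u) * (u - x1))) * (u - x1)\<^sup>2 \<le> ((f' u - s) * (v - u)) * (u - x1)\<^sup>2"
      by (simp add: power2_eq_square mult_ac)
    then have "a * ((v - u) * (u - x1)) \<le> (f' u - s) * (v - u)"
      using p by (metis mult_right_le_imp_le)
    moreover have "(v - u) * (u - x1) = \<bar>u - x1\<bar> * \<bar>v - u\<bar>"
      using uv(3) by (metis abs_mult abs_of_nonneg mult.commute)
    ultimately show ?thesis by simp
  qed (simp add: x1)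
  have "a / 2 * (v - u)\<^sup>2 \<le> f v - f u - f' u * (v - u)"
    by (rule pinched_lower[OF pinched])
  moreover have "f v - f u - s * (v - u) \<le> 2 * \<delta> / Q"
  proof -
    have "f v - f u - s * (v - u) = (f v - (s * v - t)) - (f u - (s * u - t))"
      by (simp add: algebra_simps)
    moreover have "2 * \<delta> / Q = \<delta> / Q + \<delta> / Q" by simp
    ultimately show ?thesis using E_near(1)[OF uv(1)] E_near(1)[OF uv(2)] by linarith
  qed
  ultimately have m: "a / 2 * (v - u)\<^sup>2 + a * (\<bar>u - x1\<bar> * \<bar>v - u\<bar>) \<le> 2 * \<delta> / Q"
    using nn by (simp add: algebra_simps)
  have "0 \<le> a / 2 * (v - u)\<^sup>2" "0 \<le> a * (\<bar>u - x1\<bar> * \<bar>v - u\<bar>)" using a_pos by auto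
  then have "a * (\<bar>u - x1\<bar> * \<bar>v - u\<bar>) \<le> 2 * \<delta> / Q" "a / 2 * (v - u)\<^sup>2 \<le> 2 * \<delta> / Q"
    using m by linarith+
  then show "\<bar>u - x1\<bar> * \<bar>v - u\<bar> \<le> 2 * \<delta> / (a * Q)" "\<bar>v - u\<bar>\<^sup>2 \<le> 4 * \<delta> / (a * Q)"
    using a_pos Q_pos by (simp_all add: field_simps)
qed

text \<open>Up to constants, the largest w for which both w^2 and w d are O(1/(h Q)), where d is the
  distance from the point of tangency. It is k times the minimum of 1/sqrt(h Q) and 1/(h Q d),
  written as a case distinction because division by d = 0 yields 0.\<close>

definition zone :: "real \<Rightarrow> real \<Rightarrow> real" where
  "zone h d = (if d\<^sup>2 * (h * Q) \<le> 1 then k / sqrt (h * Q) else k / (h * Q * d))"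

lemma zone_bounds:
  assumes "1 \<le> h" "0 \<le> d"
  shows "0 < zone h d" "zone h d \<le> k / sqrt (h * Q)" "zone h d * d \<le> k / (h * Q)" "zone h d \<le> 1"
proof -
  define r where "r = sqrt (h * Q)"
  have hQ: "1 \<le> h * Q" using assms Q_ge_1 by (metis mult_mono' mult_1 zero_le_one)
  have r: "1 \<le> r" "r\<^sup>2 = h * Q" "0 < r" unfolding r_def using hQ by auto
  have "0 < zone h d \<and> zone h d \<le> k / r \<and> zone h d * d \<le> k / (h * Q)"
  proof (cases "d\<^sup>2 * (h * Q) \<le> 1")
    case True
    then have "(d * r)\<^sup>2 \<le> 1\<^sup>2" by (simp add: power_mult_distrib r)
    then have dr: "d * r \<le> 1" by (rule power2_le_imp_le) simp
    have e: "zone h d = k / r" unfolding zone_def r_def using True by simp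
    have "k / r * d = k * (d * r) / r\<^sup>2" using r(3) by (simp add: power2_eq_square)
    also have "\<dots> \<le> k * 1 / r\<^sup>2"
      using dr k_pos by (intro divide_right_mono mult_left_mono) auto
    finally have "k / r * d \<le> k / r\<^sup>2" by simp
    then show ?thesis using e r k_pos by simp
  next
    case False
    then have d: "0 < d" using assms by (cases "d = 0") auto
    have "1\<^sup>2 \<le> (d * r)\<^sup>2" using False by (simp add: power_mult_distrib r)
    then have dr: "1 \<le> d * r" by (rule power2_le_imp_le) (use d r in simp)
    have e: "zone h d = k / (r\<^sup>2 * d)" unfolding zone_def r(2) using False by simp
    have "k / (r\<^sup>2 * d) = k / r / (d * r)" by (simp add: power2_eq_square mult_ac)
    also have "\<dots> \<le> k / r / 1"
      using dr r k_pos by (intro divide_left_mono) auto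
    finally have "k / (r\<^sup>2 * d) \<le> k / r" by simp
    moreover have "k / (r\<^sup>2 * d) * d \<le> k / r\<^sup>2" using d by simp
    moreover have "0 < k / (r\<^sup>2 * d)" using d r(3) k_pos by (intro divide_pos_pos mult_pos_pos) auto
    ultimately show ?thesis using e r(2) by simp
  qed
  then show "0 < zone h d" "zone h d \<le> k / sqrt (h * Q)" "zone h d * d \<le> k / (h * Q)"
    unfolding r_def by auto
  have "k / r \<le> 1" using k_le_1 r by simp
  then show "zone h d \<le> 1" using \<open>zone h d \<le> k / sqrt (h * Q)\<close> unfolding r_def by simp
qed

text \<open>A near point at distance at most w from u misses the line vertically by at most b/2 w^2
  (curvature) + b w d (angle between curve and line at u) + 2 \<delta> / Q (distances of the two
  points from the curve). Multiplied by the height and Q this is below 1, so \<open>on_line\<close>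
  applies.\<close>

lemma zone_on_line:
  assumes u: "u \<in> E s t" and x1: "f' x1 = s" and xy: "(x, y) \<in> P"
    and h: "0 < den s t" "real (den s t) * s \<in> \<int>" "real (den s t) * t \<in> \<int>" "real (den s t) * \<delta> \<le> \<kappa>"
    and near: "\<bar>x - u\<bar> \<le> zone (den s t) \<bar>u - x1\<bar>"
  shows "x \<in> E s t" "y = s * x - t"
proof -
  define H w d where "H = real (den s t)" and "w = zone H \<bar>u - x1\<bar>" and "d = \<bar>u - x1\<bar>"
  have H: "1 \<le> H" unfolding H_def using h by simp
  have HQ: "0 < H * Q" using H Q_pos by simp
  note z = zone_bounds[OF H, of d, folded w_def[folded d_def]]
  have w: "0 < w" "w * d \<le> k / (H * Q)" "w \<le> k / sqrt (H * Q)" using z unfolding d_def by auto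
  have "w\<^sup>2 \<le> (k / sqrt (H * Q))\<^sup>2" using w by (intro power_mono) auto
  also have "\<dots> = k\<^sup>2 / (H * Q)" using HQ by (simp add: power_divide)
  also have "\<dots> \<le> k / (H * Q)"
    using HQ k_pos k_le_1 by (intro divide_right_mono) (auto simp: power2_eq_square)
  finally have w2: "w\<^sup>2 \<le> k / (H * Q)" .
  have xu: "\<bar>x - u\<bar> \<le> w" using near unfolding w_def H_def .
  have "\<bar>f x - f u - f' u * (x - u)\<bar> \<le> b / 2 * (x - u)\<^sup>2"
  proof -
    have "0 \<le> a / 2 * (x - u)\<^sup>2" using a_pos by simp
    then show ?thesis using pinched_lower[OF pinched, where v=x and u=u]
      pinched_upper[OF pinched, where v=x and u=u] by linarith
  qed
  also have "\<dots> \<le> b / 2 * w\<^sup>2"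
    using xu b_pos by (intro mult_left_mono) (auto simp: abs_le_square_iff[symmetric])
  finally have e1: "\<bar>f x - f u - f' u * (x - u)\<bar> \<le> b / 2 * w\<^sup>2" .
  have "\<bar>(f' u - s) * (x - u)\<bar> \<le> (b * d) * w"
    unfolding abs_mult using pinched_abs_slope_upper[OF pinched a_pos, where v=u and u=x1] x1 xu
    unfolding d_def by (intro mult_mono) (auto simp: b_pos less_imp_le)
  then have e2: "\<bar>(f' u - s) * (x - u)\<bar> \<le> b * (w * d)" by (simp add: mult_ac)
  have e3: "\<bar>f u - (s * u - t)\<bar> < \<delta> / Q" "\<bar>f x - y\<bar> < \<delta> / Q"
    using E_near(1)[OF u] xy mem_P by auto
  have "y - (s * x - t) = (f x - f u - f' u * (x - u)) + (f' u - s) * (x - u)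
      + (f u - (s * u - t)) - (f x - y)" by (simp add: algebra_simps)
  then have "\<bar>y - (s * x - t)\<bar> \<le> b / 2 * w\<^sup>2 + b * (w * d) + 2 * (\<delta> / Q)"
    using e1 e2 e3 by linarith
  also have "\<dots> \<le> b / 2 * (k / (H * Q)) + b * (k / (H * Q)) + 2 * (\<delta> / Q)"
    using w w2 b_pos by (intro add_mono mult_left_mono) auto
  also have "\<dots> = (b * k * (3/2) + 2 * (H * \<delta>)) / (H * Q)"
    using H Q_pos by (simp add: field_simps)
  finally have "H * Q * \<bar>y - (s * x - t)\<bar> \<le> b * k * (3/2) + 2 * (H * \<delta>)"
    using HQ by (simp add: pos_le_divide_eq mult.commute)
  \<comment> \<open>The first term is at most 3/8, the second at most 1/4.\<close>
  also have "\<dots> < 1" using kb_le h(4) \<kappa>_le unfolding H_def by linarith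
  finally show y: "y = s * x - t"
    using on_line[of Q x y "den s t" s t] xy h unfolding mem_P H_def by auto
  show "x \<in> E s t" unfolding E_def using xy y by simp
qed

text \<open>The factor 1/2 ensures that a chord with a narrower zone, one end of which is within
  half of a wider zone, lies entirely in the wider one. The case near tangency needs exactly height
  times \<delta> at most k^2 a / 16, which is the origin of the second entry of
  \<open>block_const\<close>.\<close>

lemma chord_le_zone:
  assumes uv: "u \<in> E s t" "v \<in> E s t" "0 \<le> (v - u) * (u - x1)" and x1: "f' x1 = s"
    and h: "0 < den s t" "real (den s t) * \<delta> \<le> \<kappa>"
  shows "\<bar>v - u\<bar> \<le> zone (den s t) \<bar>u - x1\<bar> / 2"
proof -
  define H d where "H = real (den s t)" and "d = \<bar>u - x1\<bar>"
  have H: "1 \<le> H" unfolding H_def using h by simp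
  have HQ: "0 < H * Q" using H Q_pos by simp
  note lb = line_end_bounds[OF uv x1, folded d_def]
  have hd: "H * \<delta> \<le> k\<^sup>2 * a / 16" using h \<kappa>_le_zone unfolding H_def by simp
  show ?thesis
  proof (cases "d\<^sup>2 * (H * Q) \<le> 1")
    case True
    have "\<bar>v - u\<bar>\<^sup>2 \<le> 4 * (H * \<delta>) / (a * (H * Q))" using lb(2) H by simp
    also have "\<dots> \<le> 4 * (k\<^sup>2 * a / 16) / (a * (H * Q))"
      using hd a_pos HQ by (intro divide_right_mono mult_left_mono) auto
    also have "\<dots> = (k / sqrt (H * Q) / 2)\<^sup>2" using HQ a_pos by (simp add: power_divide)
    finally have "\<bar>v - u\<bar> \<le> k / sqrt (H * Q) / 2"
      by (rule power2_le_imp_le) (use HQ k_pos in auto)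
    then show ?thesis using True unfolding zone_def H_def d_def by simp
  next
    case False
    then have d: "0 < d" unfolding d_def by (cases "u = x1") auto
    have "k\<^sup>2 \<le> k" using k_pos k_le_1 by (simp add: power2_eq_square)
    then have "k\<^sup>2 * a \<le> k * a" using a_pos by (intro mult_right_mono) auto
    then have hd': "2 * (H * \<delta>) \<le> k * a / 2" using hd k_pos a_pos mult_pos_pos[OF k_pos a_pos] by linarith
    have "\<bar>v - u\<bar> \<le> 2 * \<delta> / (a * Q) / d" by (metis d lb(1) mult.commute pos_le_divide_eq)
    also have "\<dots> = 2 * (H * \<delta>) / (a * (H * Q) * d)" using H by simp
    also have "\<dots> \<le> (k * a / 2) / (a * (H * Q) * d)"
      using hd' a_pos HQ d by (intro divide_right_mono) auto
    also have "\<dots> = k / (H * Q * d) / 2" using a_pos by simp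
    finally show ?thesis using False unfolding zone_def H_def d_def by simp
  qed
qed

end

text \<open>The line \<open>y = s * x - t\<close> is encoded by the point \<open>(s, t)\<close>; it is nearly tangent to the graph
  of \<open>f\<close> exactly when this point is close to the graph of the dual function.\<close>

definition near_tangents ::
  "(real \<Rightarrow> real) \<Rightarrow> (real \<Rightarrow> real) \<Rightarrow> real \<Rightarrow> real \<Rightarrow> real \<Rightarrow> real \<Rightarrow> real \<Rightarrow> (real \<times> real) set" where
  "near_tangents f f' b \<alpha> l Q A =
     {(s, t). (\<exists>n>0. real n * s \<in> \<int> \<and> real n * t \<in> \<int>) \<and> real (den s t) < A \<and>
        s \<in> {f' (\<alpha> - 1)..f' (\<alpha> - 1) + b * (l + 2)} \<and>
        \<bar>dual f f' s - t\<bar> \<le> (1 + b) / (real (den s t) * Q)}"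

context near_curve
begin

text \<open>Each line is charged to its zone or to the dual sum \<Sigma>. Steep lines have chord at
  most 2 \<delta> / (a Q d) and zone k / (H Q d), so they cost O(\<delta> Q^2) times the zone. A
  flat line has chord O(sqrt(\<delta>/Q)) and costs O(Q sqrt(Q \<delta>) / H): if H >= A, one factor
  1/sqrt H is at most 1/sqrt A and the other belongs to the zone k / sqrt(H Q); if H < A, the sum of
  1/H is left to the dual curve.\<close>

lemma sum_card_lines:
  assumes fin: "finite \<L>" and A: "0 < A"
    and good: "\<And>s t. (s, t) \<in> \<L> \<Longrightarrow> 3 \<le> card (E s t) \<and> real (den s t) * \<delta> \<le> \<kappa>"
    and dual_sum: "\<And>T. finite T \<Longrightarrow> T \<subseteq> near_tangents f f' b \<alpha> l Q A \<Longrightarrow> (\<Sum>(s, t)\<in>T. 1 / real (den s t)) \<le> \<Sigma>"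
  shows "(\<Sum>(s, t)\<in>\<L>. real (card (E s t))) \<le>
    16 * (l + 1) / (a * k) * (\<delta> * Q\<^sup>2) + 16 * (l + 1) / (k * sqrt a) * (Q\<^sup>2 * sqrt (\<delta> / A))
      + 8 / sqrt a * (Q * sqrt (Q * \<delta>) * \<Sigma>)"
proof -
  have "\<exists>uv. fst uv \<in> E s t \<and> snd uv \<in> E s t \<and> fst uv \<noteq> snd uv \<and>
      0 \<le> (snd uv - fst uv) * (fst uv - dual_slope f' s) \<and>
      real (card (E s t)) \<le> 4 * Q\<^sup>2 * \<bar>snd uv - fst uv\<bar> / real (den s t)" if "(s, t) \<in> \<L>" for s t
    using line_end[of s t "dual_slope f' s"] good[OF that] by (metis fst_conv snd_conv)
  then obtain uv where uv: "fst (uv s t) \<in> E s t" "snd (uv s t) \<in> E s t" "fst (uv s t) \<noteq> snd (uv s t)"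
      "0 \<le> (snd (uv s t) - fst (uv s t)) * (fst (uv s t) - dual_slope f' s)"
      "real (card (E s t)) \<le> 4 * Q\<^sup>2 * \<bar>snd (uv s t) - fst (uv s t)\<bar> / real (den s t)"
    if "(s, t) \<in> \<L>" for s t
    by metis
  define u v d w where "u p = fst (uv (fst p) (snd p))" and "v p = snd (uv (fst p) (snd p))"
    and "d p = \<bar>u p - dual_slope f' (fst p)\<bar>" and "w p = zone (den (fst p) (snd p)) (d p)"
    for p :: "real \<times> real"
  define H where "H p = real (den (fst p) (snd p))" for p
  define e where "e p = E (fst p) (snd p)" for p
  have slope: "f' (dual_slope f' s) = s" for s by (rule dual_slope[OF pinched a_pos])
  have u: "u p \<in> e p" "v p \<in> e p" "u p \<noteq> v p" "0 \<le> (v p - u p) * (u p - dual_slope f' (fst p))"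
      "real (card (e p)) \<le> 4 * Q\<^sup>2 * \<bar>v p - u p\<bar> / H p" if "p \<in> \<L>" for p
    using uv[of "fst p" "snd p"] that unfolding u_def v_def e_def H_def by auto
  have den: "0 < den (fst p) (snd p)" "H p * fst p \<in> \<int>" "H p * snd p \<in> \<int>" if "p \<in> \<L>" for p
    using E_gap[OF u(1-3)[OF that, unfolded e_def]] unfolding H_def by auto
  have H1: "1 \<le> H p" if "p \<in> \<L>" for p using den(1)[OF that] unfolding H_def by simp
  have H\<delta>: "H p * \<delta> \<le> \<kappa>" if "p \<in> \<L>" for p using good[of "fst p" "snd p"] that unfolding H_def by simp
  have d0: "0 \<le> d p" for p unfolding d_def by simp
  note zb = zone_bounds[OF H1 d0]
  have w: "0 < w p \<and> w p \<le> 1" if "p \<in> \<L>" for p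
    using zb[OF that] unfolding w_def H_def by auto
  have chord: "\<bar>v p - u p\<bar> \<le> w p / 2" if "p \<in> \<L>" for p
    using chord_le_zone[OF u(1,2)[OF that, unfolded e_def] u(4)[OF that] slope den(1)[OF that]]
      H\<delta>[OF that] unfolding w_def d_def H_def by simp
  have lb: "d p * \<bar>v p - u p\<bar> \<le> 2 * \<delta> / (a * Q)" "\<bar>v p - u p\<bar>\<^sup>2 \<le> 4 * \<delta> / (a * Q)" if "p \<in> \<L>" for p
    using line_end_bounds[OF u(1,2)[OF that, unfolded e_def] u(4)[OF that] slope]
    unfolding d_def by auto
  have captured: "snd q = fst p * fst q - snd p"
    if "p \<in> \<L>" "q \<in> P" "\<bar>fst q - u p\<bar> \<le> w p" for p q
    using zone_on_line(2)[OF u(1)[OF that(1), unfolded e_def] slope _ den(1)[OF that(1)], of "fst q" "snd q"]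
      den(2,3)[OF that(1)] H\<delta>[OF that(1)] that(2,3) unfolding w_def d_def H_def by simp
  \<comment> \<open>Otherwise both ends of chord j lie in the zone of i, hence on line i; two
    distinct points determine a line, so i = j.\<close>
  have sep: "w i / 2 \<le> \<bar>u i - u j\<bar>" if ij: "i \<in> \<L>" "j \<in> \<L>" "i \<noteq> j" "w j \<le> w i" for i j
  proof (rule ccontr)
    assume "\<not> w i / 2 \<le> \<bar>u i - u j\<bar>"
    then have n: "\<bar>u j - u i\<bar> \<le> w i" "\<bar>v j - u i\<bar> \<le> w i"
      using chord[OF ij(2)] ij(4) by linarith+
    have P: "(u j, fst j * u j - snd j) \<in> P" "(v j, fst j * v j - snd j) \<in> P"
      using u(1,2)[OF ij(2)] unfolding e_def E_def by auto
    have eq: "fst j * u j - snd j = fst i * u j - snd i" "fst j * v j - snd j = fst i * v j - snd i"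
      using captured[OF ij(1) P(1)] captured[OF ij(1) P(2)] n by auto
    have "fst j * (u j - v j) = fst i * (u j - v j)" using eq by (simp add: algebra_simps)
    then have "fst j = fst i" using u(3)[OF ij(2)] by simp
    moreover from this have "snd j = snd i" using eq(1) by simp
    ultimately show False using ij(3) by (simp add: prod_eq_iff)
  qed
  have sum_w: "sum w \<L>' \<le> 2 * (l + 1)" if "\<L>' \<subseteq> \<L>" for \<L>'
  proof (rule sum_zones_le[where u = u and \<alpha> = \<alpha>])
    show "finite \<L>'" using fin that finite_subset by blast
    show "u i \<in> {\<alpha>..\<alpha> + l}" if "i \<in> \<L>'" for i
      using E_near(3) u(1) \<open>\<L>' \<subseteq> \<L>\<close> that unfolding e_def by blast
    show "0 < w i \<and> w i \<le> 1" if "i \<in> \<L>'" for i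
      using w \<open>\<L>' \<subseteq> \<L>\<close> that by blast
    show "w i / 2 \<le> \<bar>u i - u j\<bar>" if "i \<in> \<L>'" "j \<in> \<L>'" "i \<noteq> j" "w j \<le> w i" for i j
      using sep \<open>\<L>' \<subseteq> \<L>\<close> that by blast
  qed (rule l_nonneg)
  define N where "N p = real (card (e p))" for p
  define steep flat where "steep = {p \<in> \<L>. 1 < (d p)\<^sup>2 * (H p * Q)}"
    and "flat = {p \<in> \<L>. (d p)\<^sup>2 * (H p * Q) \<le> 1}"
  have steep_le: "N p \<le> 8 / (a * k) * (\<delta> * Q\<^sup>2) * w p" if "p \<in> steep" for p
  proof -
    have p: "p \<in> \<L>" "\<not> (d p)\<^sup>2 * (H p * Q) \<le> 1" using that unfolding steep_def by auto
    have d: "0 < d p" using p(2) d0[of p] by (cases "d p = 0") auto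
    have we: "w p = k / (H p * Q * d p)" using p(2) unfolding w_def zone_def H_def by simp
    have "\<bar>v p - u p\<bar> \<le> 2 * \<delta> / (a * Q) / d p" by (metis d lb(1)[OF p(1)] mult.commute pos_le_divide_eq)
    then have "4 * Q\<^sup>2 * \<bar>v p - u p\<bar> / H p \<le> 4 * Q\<^sup>2 * (2 * \<delta> / (a * Q) / d p) / H p"
      using H1[OF p(1)] by (intro divide_right_mono mult_left_mono) auto
    also have "\<dots> = 8 / (a * k) * (\<delta> * Q\<^sup>2) * w p"
      unfolding we using a_pos k_pos Q_pos d H1[OF p(1)] by (simp add: field_simps power2_eq_square)
    finally show ?thesis using u(5)[OF p(1)] unfolding N_def by simp
  qed
  define S where "S = sqrt Q"
  have S: "0 < S" "S * S = Q" unfolding S_def using Q_pos by auto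
  have flat_le: "N p \<le> 8 / sqrt a * (Q * sqrt (Q * \<delta>)) * (1 / H p)" if "p \<in> flat" for p
  proof -
    have p: "p \<in> \<L>" using that unfolding flat_def by auto
    have "\<bar>v p - u p\<bar> \<le> sqrt (4 * \<delta> / (a * Q))" using lb(2)[OF p] by (simp add: real_le_rsqrt)
    also have "\<dots> = 2 * sqrt \<delta> / (sqrt a * sqrt Q)" by (simp add: real_sqrt_divide real_sqrt_mult)
    finally have "4 * Q\<^sup>2 * \<bar>v p - u p\<bar> / H p \<le> 4 * Q\<^sup>2 * (2 * sqrt \<delta> / (sqrt a * sqrt Q)) / H p"
      using H1[OF p] by (intro divide_right_mono mult_left_mono) auto
    also have "4 * Q\<^sup>2 * (2 * sqrt \<delta> / (sqrt a * sqrt Q)) / H p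
        = 4 * (Q * (S * S)) * (2 * sqrt \<delta> / (sqrt a * S)) / H p"
      unfolding S_def[symmetric] by (simp add: power2_eq_square S)
    also have "\<dots> = 8 / sqrt a * (Q * (S * sqrt \<delta>)) * (1 / H p)"
      using S(1) by simp
    also have "S * sqrt \<delta> = sqrt (Q * \<delta>)" unfolding S_def by (simp add: real_sqrt_mult)
    finally show ?thesis using u(5)[OF p] unfolding N_def by simp
  qed
  have high_le: "N p \<le> 8 / (k * sqrt a) * (Q\<^sup>2 * sqrt (\<delta> / A)) * w p" if "p \<in> flat" "A \<le> H p" for p
  proof -
    have p: "p \<in> \<L>" "(d p)\<^sup>2 * (H p * Q) \<le> 1" using that unfolding flat_def by auto
    have we: "w p = k / sqrt (H p * Q)" using p(2) unfolding w_def zone_def H_def by simp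
    have sA: "0 < sqrt A" "sqrt A \<le> sqrt (H p)" using A that by auto
    have sH: "H p = sqrt (H p) * sqrt (H p)" using H1[OF p(1)] by simp
    have "8 / sqrt a * (Q * sqrt (Q * \<delta>)) * (1 / H p)
       = 8 / sqrt a * (Q * sqrt (Q * \<delta>)) * (1 / sqrt (H p)) * (1 / sqrt (H p))"
      by (subst sH) simp
    also have "\<dots> \<le> 8 / sqrt a * (Q * sqrt (Q * \<delta>)) * (1 / sqrt (H p)) * (1 / sqrt A)"
      using sA a_pos Q_pos \<delta>_pos H1[OF p(1)] by (intro mult_left_mono divide_left_mono) auto
    also have "\<dots> = 8 / (k * sqrt a) * (Q * (S * S) * sqrt (\<delta> / A)) * w p"
      unfolding we real_sqrt_mult real_sqrt_divide S_def[symmetric] using k_pos S(1) by simp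
    also have "Q * (S * S) = Q\<^sup>2" by (simp add: power2_eq_square S)
    finally show ?thesis using flat_le[OF that(1)] by simp
  qed
  \<comment> \<open>Flatness gives d <= 1/sqrt(H Q) <= 1, so the point of tangency is within 1 of
    the interval; hence the range of slopes in \<open>near_tangents\<close>. The dual misses t by
    the Taylor remainder at x1, at most b / (2 H Q), plus \<delta> / Q, which is at most 1 / (H Q)
    because H \<delta> <= \<kappa> <= 1.\<close>
  have flat_dual: "p \<in> near_tangents f f' b \<alpha> l Q A" if "p \<in> flat" "H p < A" for p
  proof -
    have p: "p \<in> \<L>" "(d p)\<^sup>2 * (H p * Q) \<le> 1" using that unfolding flat_def by auto
    define x1 where "x1 = dual_slope f' (fst p)"
    have HQ: "1 \<le> H p * Q" using H1[OF p(1)] Q_ge_1 by (metis mult_mono' mult_1 zero_le_one)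
    have d2: "(d p)\<^sup>2 \<le> 1 / (H p * Q)" using p(2) HQ by (simp add: field_simps)
    also have "\<dots> \<le> 1\<^sup>2" using HQ by simp
    finally have d1: "d p \<le> 1" by (rule power2_le_imp_le) simp
    have up: "u p \<in> {\<alpha>..\<alpha> + l}" "\<bar>f (u p) - (fst p * u p - snd p)\<bar> < \<delta> / Q"
      using E_near[of "u p"] u(1)[OF p(1)] unfolding e_def by auto
    have x1: "\<alpha> - 1 \<le> x1" "x1 \<le> \<alpha> + l + 1" using up(1) d1 unfolding d_def x1_def by auto
    have f1: "f' x1 = fst p" unfolding x1_def by (rule slope)
    have r: "fst p \<in> {f' (\<alpha> - 1)..f' (\<alpha> - 1) + b * (l + 2)}"
    proof -
      have "f' (\<alpha> - 1) \<le> f' x1" using x1(1) pinched_strict_mono[OF pinched a_pos]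
        by (metis less_eq_real_def)
      moreover have "\<bar>f' x1 - f' (\<alpha> - 1)\<bar> \<le> b * \<bar>x1 - (\<alpha> - 1)\<bar>"
        by (rule pinched_abs_slope_upper[OF pinched a_pos])
      moreover have "b * \<bar>x1 - (\<alpha> - 1)\<bar> \<le> b * (l + 2)"
        using x1 b_pos by (intro mult_left_mono) auto
      ultimately show ?thesis using f1 by auto
    qed
    have "f (u p) - f x1 - fst p * (u p - x1) \<le> b / 2 * (u p - x1)\<^sup>2"
      "a / 2 * (u p - x1)\<^sup>2 \<le> f (u p) - f x1 - fst p * (u p - x1)"
      using pinched_upper[OF pinched, where u=x1 and v="u p"]
        pinched_lower[OF pinched, where u=x1 and v="u p"] f1 by auto
    moreover have "0 \<le> a / 2 * (u p - x1)\<^sup>2" using a_pos by simp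
    moreover have "b / 2 * (u p - x1)\<^sup>2 \<le> b / 2 * (1 / (H p * Q))"
      using d2 b_pos unfolding d_def x1_def[symmetric] by (intro mult_left_mono) auto
    moreover have "dual f f' (fst p) - snd p = (f (u p) - f x1 - fst p * (u p - x1)) - (f (u p) - (fst p * u p - snd p))"
      unfolding dual_def x1_def[symmetric] by (simp add: algebra_simps)
    ultimately have "\<bar>dual f f' (fst p) - snd p\<bar> \<le> b / 2 * (1 / (H p * Q)) + \<delta> / Q"
      using up(2) by linarith
    also have "\<delta> / Q = H p * \<delta> / (H p * Q)" using H1[OF p(1)] by simp
    also have "b / 2 * (1 / (H p * Q)) + H p * \<delta> / (H p * Q) \<le> b * (1 / (H p * Q)) + 1 / (H p * Q)"
      using H\<delta>[OF p(1)] \<kappa>_le HQ b_pos by (intro add_mono divide_right_mono mult_right_mono) auto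
    also have "\<dots> = (1 + b) / (H p * Q)" by (simp add: add_divide_distrib)
    finally have "\<bar>dual f f' (fst p) - snd p\<bar> \<le> (1 + b) / (H p * Q)" .
    then show ?thesis using r that den[OF p(1)] unfolding near_tangents_def H_def by (auto simp: case_prod_beta)
  qed
  define low high where "low = {p \<in> flat. H p < A}" and "high = {p \<in> flat. A \<le> H p}"
  have fins: "finite steep" "finite low" "finite high"
    using fin unfolding steep_def low_def high_def flat_def by auto
  have "\<L> = steep \<union> (high \<union> low)" "steep \<inter> (high \<union> low) = {}" "high \<inter> low = {}"
    unfolding steep_def low_def high_def flat_def by auto
  then have "sum N \<L> = sum N steep + (sum N high + sum N low)"
    using fins by (simp add: sum.union_disjoint)
  also have "sum N steep \<le> 8 / (a * k) * (\<delta> * Q\<^sup>2) * (2 * (l + 1))"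
  proof -
    have "sum N steep \<le> (\<Sum>p\<in>steep. 8 / (a * k) * (\<delta> * Q\<^sup>2) * w p)" by (rule sum_mono) (rule steep_le)
    also have "\<dots> = 8 / (a * k) * (\<delta> * Q\<^sup>2) * sum w steep" by (simp add: sum_distrib_left)
    also have "\<dots> \<le> 8 / (a * k) * (\<delta> * Q\<^sup>2) * (2 * (l + 1))"
      using a_pos k_pos \<delta>_pos by (intro mult_left_mono sum_w) (auto simp: steep_def)
    finally show ?thesis .
  qed
  also have "sum N high \<le> 8 / (k * sqrt a) * (Q\<^sup>2 * sqrt (\<delta> / A)) * (2 * (l + 1))"
  proof -
    have "sum N high \<le> (\<Sum>p\<in>high. 8 / (k * sqrt a) * (Q\<^sup>2 * sqrt (\<delta> / A)) * w p)"
      by (rule sum_mono, rule high_le) (simp_all add: high_def)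
    also have "\<dots> = 8 / (k * sqrt a) * (Q\<^sup>2 * sqrt (\<delta> / A)) * sum w high" by (simp add: sum_distrib_left)
    also have "\<dots> \<le> 8 / (k * sqrt a) * (Q\<^sup>2 * sqrt (\<delta> / A)) * (2 * (l + 1))"
      using a_pos k_pos \<delta>_pos A by (intro mult_left_mono sum_w) (auto simp: high_def flat_def)
    finally show ?thesis .
  qed
  also have "sum N low \<le> 8 / sqrt a * (Q * sqrt (Q * \<delta>)) * \<Sigma>"
  proof -
    have "sum N low \<le> (\<Sum>p\<in>low. 8 / sqrt a * (Q * sqrt (Q * \<delta>)) * (1 / H p))"
      by (rule sum_mono, rule flat_le) (simp add: low_def)
    also have "\<dots> = 8 / sqrt a * (Q * sqrt (Q * \<delta>)) * (\<Sum>p\<in>low. 1 / H p)" by (simp only: sum_distrib_left)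
    also have "\<dots> \<le> 8 / sqrt a * (Q * sqrt (Q * \<delta>)) * \<Sigma>"
    proof (rule mult_left_mono)
      have "(\<Sum>(s, t)\<in>low. 1 / real (den s t)) \<le> \<Sigma>"
        using fins(2) flat_dual by (intro dual_sum) (auto simp: low_def)
      then show "(\<Sum>p\<in>low. 1 / H p) \<le> \<Sigma>" unfolding H_def by (simp add: case_prod_beta)
    qed (use a_pos Q_pos \<delta>_pos in auto)
    finally show ?thesis .
  qed
  finally show ?thesis unfolding N_def e_def by (simp add: case_prod_beta algebra_simps)
qed

end

section \<open>Blocks and vertical lines\<close>

text \<open>One summand for each source of points: blocks with at most two points, vertical lines,
  steep lines, flat lines of large height, flat lines of small height.\<close>

definition curve_const :: "real \<Rightarrow> real \<Rightarrow> real \<Rightarrow> real" where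
  "curve_const a b l = 2 * (l / block_const a b + 1) + 8 * (l + 1)
     + 16 * (l + 1) / (a * zone_const b) + 16 * (l + 1) / (zone_const b * sqrt a) + 8 / sqrt a"

context near_curve
begin

text \<open>Two points of the block give the candidate line. Subtracting the tangent of f at x1 from
  the ordinates does not change the determinants and leaves only the strip width and the curvature
  over the block. For the height: points on the line are at least height / Q^2 apart but fit into
  length \<kappa> / (Q^2 \<delta>).\<close>

lemma block_on_line:
  assumes B: "B \<subseteq> P" "3 \<le> card B" "inj_on fst B"
    and short: "\<And>p q. p \<in> B \<Longrightarrow> q \<in> B \<Longrightarrow> \<bar>fst p - fst q\<bar> \<le> \<kappa> / (Q\<^sup>2 * \<delta>)"
  shows "\<exists>s t. 3 \<le> card (E s t) \<and> real (den s t) * \<delta> \<le> \<kappa> \<and> B \<subseteq> (\<lambda>x. (x, s * x - t)) ` E s t"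
proof -
  define L where "L = \<kappa> / (Q\<^sup>2 * \<delta>)"
  have L: "0 \<le> L" unfolding L_def using \<kappa>_pos Q_pos \<delta>_pos by simp
  have finB: "finite B" using B(2) card.infinite by fastforce
  have "\<not> B \<subseteq> {p}" for p
  proof
    assume "B \<subseteq> {p}"
    then have "card B \<le> 1" using card_mono[of "{p}" B] by simp
    then show False using B(2) by simp
  qed
  then obtain p q where pq: "p \<in> B" "q \<in> B" "p \<noteq> q" by blast
  obtain x1 y1 x2 y2 where p: "p = (x1, y1)" and q: "q = (x2, y2)" by fastforce
  have x12: "x1 \<noteq> x2" using inj_onD[OF B(3) _ pq(1,2)] pq(3) p q by auto
  define s t where "s = (y2 - y1) / (x2 - x1)" and "t = s * x1 - y1"
  have col: "y = s * x - t" if r: "(x, y) \<in> B" for x y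
  proof -
    define \<epsilon> where "\<epsilon> = \<delta> / Q"
    define R where "R x y = y - f x1 - f' x1 * (x - x1)" for x y
    have R: "\<bar>R x y\<bar> \<le> \<epsilon> + b / 2 * L\<^sup>2" if "(x, y) \<in> B" for x y
    proof -
      have "0 \<le> a / 2 * (x - x1)\<^sup>2" using a_pos by simp
      then have "\<bar>f x - f x1 - f' x1 * (x - x1)\<bar> \<le> b / 2 * (x - x1)\<^sup>2"
        using pinched_lower[OF pinched, where v=x and u=x1]
          pinched_upper[OF pinched, where v=x and u=x1] by linarith
      also have "\<dots> \<le> b / 2 * L\<^sup>2"
      proof -
        have "\<bar>x - x1\<bar> \<le> L" using short[OF that pq(1)] p unfolding L_def by simp
        then have "\<bar>x - x1\<bar>\<^sup>2 \<le> L\<^sup>2" by (rule power_mono) simp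
        then show ?thesis using b_pos by (intro mult_left_mono) auto
      qed
      finally have "\<bar>f x - f x1 - f' x1 * (x - x1)\<bar> \<le> b / 2 * L\<^sup>2" .
      moreover have "\<bar>f x - y\<bar> < \<epsilon>" using that B(1) mem_P[of x y] unfolding \<epsilon>_def by auto
      ultimately show ?thesis unfolding R_def by linarith
    qed
    have R1: "\<bar>R x1 y1\<bar> \<le> \<epsilon>" using pq(1) B(1) mem_P[of x1 y1] unfolding R_def \<epsilon>_def p by auto
    have d: "\<bar>x2 - x1\<bar> \<le> L" "\<bar>x - x1\<bar> \<le> L"
      using short[OF pq(2,1)] short[OF r pq(1)] p q unfolding L_def by auto
    have "(x2 - x1) * (y - y1) - (x - x1) * (y2 - y1)
        = (x2 - x1) * (R x y - R x1 y1) - (x - x1) * (R x2 y2 - R x1 y1)"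
      unfolding R_def by (simp add: algebra_simps)
    also have "\<bar>\<dots>\<bar> \<le> \<bar>x2 - x1\<bar> * \<bar>R x y - R x1 y1\<bar> + \<bar>x - x1\<bar> * \<bar>R x2 y2 - R x1 y1\<bar>"
      unfolding abs_mult[symmetric] by (rule abs_triangle_ineq4)
    also have "\<dots> \<le> L * (2 * \<epsilon> + b / 2 * L\<^sup>2) + L * (2 * \<epsilon> + b / 2 * L\<^sup>2)"
      using d L R[OF r] R[OF pq(2)[unfolded q]] R1
      by (intro add_mono mult_mono) auto
    also have "\<dots> = 4 * (L * \<epsilon>) + b * L ^ 3" by (simp add: algebra_simps power2_eq_square power3_eq_cube)
    finally have "Q ^ 3 * \<bar>(x2 - x1) * (y - y1) - (x - x1) * (y2 - y1)\<bar>
        \<le> Q ^ 3 * (4 * (L * \<epsilon>) + b * L ^ 3)"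
      using Q_pos by (intro mult_left_mono) auto
    also have "\<dots> = 4 * (Q ^ 3 * (L * \<epsilon>)) + b * (Q * L) ^ 3" by (simp add: algebra_simps power_mult_distrib)
    also have "Q ^ 3 * (L * \<epsilon>) = \<kappa>" unfolding L_def \<epsilon>_def using Q_pos \<delta>_pos
      by (simp add: power2_eq_square power3_eq_cube)
    also have "4 * \<kappa> + b * (Q * L) ^ 3 \<le> 4 * \<kappa> + b * \<kappa>"
    proof -
      have QL: "Q * L = \<kappa> / (\<delta> * Q)" unfolding L_def using Q_pos \<delta>_pos by (simp add: power2_eq_square)
      have "\<kappa> / (\<delta> * Q) \<le> \<kappa> / 1" using \<delta>Q_ge_1 \<kappa>_pos by (intro divide_left_mono) auto
      then have 1: "Q * L \<le> \<kappa>" "0 \<le> Q * L"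
        using QL mult_nonneg_nonneg[OF less_imp_le[OF Q_pos] L] by simp_all
      then have "(Q * L) ^ 3 \<le> (Q * L) ^ 1" using \<kappa>_le by (intro power_decreasing) auto
      then show ?thesis using 1 b_pos by (intro add_left_mono mult_left_mono) auto
    qed
    also have "\<dots> < 1" using \<kappa>_le b\<kappa>_le by linarith
    finally have "(x2 - x1) * (y - y1) = (x - x1) * (y2 - y1)"
      using collinear_triple[of Q x1 y1 x2 y2 x y] pq r B(1) p q mem_P by blast
    moreover have "s * (x2 - x1) = y2 - y1" unfolding s_def using x12 by simp
    ultimately have "(x2 - x1) * (y - y1) = (x2 - x1) * (s * (x - x1))" by (metis mult.assoc mult.commute)
    then have "y - y1 = s * (x - x1)" using x12 by simp
    then show ?thesis unfolding t_def by (simp add: algebra_simps)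
  qed
  have sub: "fst ` B \<subseteq> E s t" using col B(1) unfolding E_def by auto
  have cB: "card (fst ` B) = card B" using B(3) by (rule card_image)
  then have 3: "3 \<le> card (E s t)" using card_mono[OF finite_E sub] B(2) by simp
  have g: "(real (card (fst ` B)) - 1) * (real (den s t) / Q\<^sup>2) \<le> Max (fst ` B) - Min (fst ` B)"
    "Max (fst ` B) \<in> fst ` B" "Min (fst ` B) \<in> fst ` B"
    using gap_card_E[OF sub] cB B(2) by auto
  have "1 * (real (den s t) / Q\<^sup>2) \<le> (real (card (fst ` B)) - 1) * (real (den s t) / Q\<^sup>2)"
    using B(2) cB by (intro mult_right_mono) auto
  also have "\<dots> \<le> \<kappa> / (Q\<^sup>2 * \<delta>)" using g short by force
  finally have "real (den s t) * \<delta> \<le> \<kappa>" using Q_pos \<delta>_pos by (simp add: field_simps)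
  moreover have "B \<subseteq> (\<lambda>x. (x, s * x - t)) ` E s t" using col sub by force
  ultimately show ?thesis using 3 by blast
qed

section \<open>Near points on vertical lines\<close>

definition Y :: "real \<Rightarrow> real set" where
  "Y x = {y. (x, y) \<in> P}"

text \<open>These abscissae are split off because a vertical line has no equation y = s x - t and
  \<open>block_on_line\<close> relies on distinct abscissae.\<close>

definition V :: "real set" where
  "V = {x. 2 \<le> card (Y x)}"

lemma finite_Y: "finite (Y x)"
proof -
  have "Y x \<subseteq> snd ` P" unfolding Y_def by force
  then show ?thesis using finite_P finite_surj by blast
qed

lemma finite_V: "finite V"
proof -
  have "V \<subseteq> fst ` P"
  proof
    fix x assume "x \<in> V"
    then have "Y x \<noteq> {}" unfolding V_def by auto
    then show "x \<in> fst ` P" unfolding Y_def by force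
  qed
  then show ?thesis using finite_P finite_surj by blast
qed

text \<open>\<open>den x 0\<close> is the denominator of x alone, since 0 imposes no
  condition.\<close>

lemma V_den:
  assumes "x \<in> V"
  shows "0 < den x 0" "real (den x 0) \<le> Q" "real (den x 0) * x \<in> \<int>" "x \<in> {\<alpha>..\<alpha> + l}"
proof -
  have "Y x \<noteq> {}" using assms unfolding V_def by auto
  then obtain y where y: "(x, y) \<in> P" unfolding Y_def by auto
  then obtain q :: nat where q: "1 \<le> q" "real q \<le> Q" "real q * x \<in> \<int>"
    unfolding mem_P rational_upto_def by auto
  have "0 < q" using q by simp
  note d = den_pos[OF this q(3), of 0] den_fst[OF this q(3), of 0] den_le[OF this q(3), of 0]
  show "0 < den x 0" "real (den x 0) * x \<in> \<int>" using d by auto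
  have "real (den x 0) \<le> real q" using d by simp
  then show "real (den x 0) \<le> Q" using q(2) by linarith
  show "x \<in> {\<alpha>..\<alpha> + l}" using y unfolding mem_P by simp
qed

text \<open>The denominators of both points are multiples q = h n and q' = h n' of h =
  \<open>den x 0\<close>, so the ordinates differ by a multiple of 1/(h n n'), and h n n' = q q' / h
  <= Q^2 / h.\<close>

lemma Y_gap:
  assumes "y \<in> Y x" "y' \<in> Y x" "y < y'"
  shows "real (den x 0) / Q\<^sup>2 \<le> y' - y"
proof -
  define h where "h = den x 0"
  have r: "rational_upto Q (x, y)" "rational_upto Q (x, y')" using assms mem_P unfolding Y_def by auto
  obtain q :: nat where q: "1 \<le> q" "real q \<le> Q" "real q * x \<in> \<int>" "real q * y \<in> \<int>"
    using r(1) unfolding rational_upto_def by auto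
  obtain q' :: nat where q': "1 \<le> q'" "real q' \<le> Q" "real q' * x \<in> \<int>" "real q' * y' \<in> \<int>"
    using r(2) unfolding rational_upto_def by auto
  have "int h dvd int q" "int h dvd int q'"
    unfolding h_def using den_dvd[of "int q" x 0] den_dvd[of "int q'" x 0] q q' by auto
  then obtain n n' where n: "q = h * n" "q' = h * n'" by (auto elim!: dvdE)
  define z where "z = real h * real n * real n' * (y' - y)"
  have "z = real n * (real q' * y') - real n' * (real q * y)"
    unfolding z_def n by (simp add: algebra_simps)
  then have "z \<in> \<int>" using q q' by simp
  moreover have "0 < z" unfolding z_def using n q q' assms by auto
  ultimately have "1 \<le> z" using Ints_nonzero_abs_ge1[of z] by auto
  then have "real h * 1 \<le> real h * z" by (intro mult_left_mono) auto
  also have "\<dots> = (real q * real q') * (y' - y)" unfolding z_def n by simp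
  also have "\<dots> \<le> Q\<^sup>2 * (y' - y)"
    unfolding power2_eq_square using q q' assms by (intro mult_right_mono mult_mono) auto
  finally show ?thesis using Q_pos unfolding h_def by (simp add: field_simps)
qed

text \<open>A fibre has length below 2 \<delta> / Q and gaps at least h / Q^2, hence O(\<delta> Q /
  h) points. Distinct fractions with denominators h, h' <= Q are at least 1/(h h') >= 1/(h Q) apart,
  so the weights 1/(h Q) can play the role of zones.\<close>

lemma sum_card_vertical: "(\<Sum>x\<in>V. real (card (Y x))) \<le> 8 * (l + 1) * (\<delta> * Q\<^sup>2)"
proof -
  define w where "w x = 1 / (real (den x 0) * Q)" for x
  have one: "real (card (Y x)) \<le> 4 * (\<delta> * Q\<^sup>2) * w x" if x: "x \<in> V" for x
  proof -
    have c2: "2 \<le> card (Y x)" using x unfolding V_def by simp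
    then have ne: "Y x \<noteq> {}" by auto
    note d = V_den[OF x]
    have "(real (card (Y x)) - 1) * (real (den x 0) / Q\<^sup>2) \<le> Max (Y x) - Min (Y x)"
      by (rule gap_card[OF finite_Y ne]) (rule Y_gap)
    also have "\<dots> \<le> 2 * (\<delta> / Q)"
    proof -
      have "Max (Y x) \<in> Y x" "Min (Y x) \<in> Y x" using finite_Y ne by auto
      then have "\<bar>f x - Max (Y x)\<bar> < \<delta> / Q" "\<bar>f x - Min (Y x)\<bar> < \<delta> / Q"
        unfolding Y_def mem_Collect_eq mem_P by auto
      then show ?thesis by linarith
    qed
    finally have "real (card (Y x)) - 1 \<le> 2 * (\<delta> / Q) / (real (den x 0) / Q\<^sup>2)"
      using d Q_pos by (subst pos_le_divide_eq) auto
    also have "\<dots> = 2 * (\<delta> * Q\<^sup>2) * w x"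
      unfolding w_def using d Q_pos by (simp add: field_simps power2_eq_square)
    finally show ?thesis using c2 by linarith
  qed
  have sw: "sum w V \<le> 2 * (l + 1)"
  proof (rule sum_zones_le[where u = "\<lambda>x. x" and \<alpha> = \<alpha>])
    show "0 < w x \<and> w x \<le> 1" if "x \<in> V" for x
    proof -
      have "1 * 1 \<le> real (den x 0) * Q" using V_den[OF that] Q_ge_1 by (intro mult_mono) auto
      then show ?thesis unfolding w_def by simp
    qed
    show "w x / 2 \<le> \<bar>x - x'\<bar>" if xx: "x \<in> V" "x' \<in> V" "x \<noteq> x'" for x x'
    proof -
      note d = V_den[OF xx(1)] and d' = V_den[OF xx(2)]
      define z where "z = real (den x 0) * real (den x' 0) * (x - x')"
      have "z = real (den x' 0) * (real (den x 0) * x) - real (den x 0) * (real (den x' 0) * x')"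
        unfolding z_def by (simp add: algebra_simps)
      then have "z \<in> \<int>" using d d' by simp
      moreover have "z \<noteq> 0" unfolding z_def using d d' xx by simp
      ultimately have "1 \<le> \<bar>z\<bar>" by (rule Ints_nonzero_abs_ge1)
      also have "\<bar>z\<bar> = real (den x 0) * real (den x' 0) * \<bar>x - x'\<bar>" unfolding z_def by (simp add: abs_mult)
      also have "\<dots> \<le> real (den x 0) * Q * \<bar>x - x'\<bar>"
        using d' by (intro mult_right_mono mult_left_mono) auto
      finally have "w x \<le> \<bar>x - x'\<bar>" unfolding w_def using d Q_pos by (simp add: field_simps)
      moreover have "0 \<le> w x" unfolding w_def using Q_pos by simp
      ultimately show ?thesis by linarith
    qed
  qed (use finite_V V_den(4) l_nonneg in auto)
  have "(\<Sum>x\<in>V. real (card (Y x))) \<le> (\<Sum>x\<in>V. 4 * (\<delta> * Q\<^sup>2) * w x)" by (rule sum_mono) (rule one)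
  also have "\<dots> = 4 * (\<delta> * Q\<^sup>2) * sum w V" by (simp add: sum_distrib_left)
  also have "\<dots> \<le> 4 * (\<delta> * Q\<^sup>2) * (2 * (l + 1))" using sw \<delta>_pos by (intro mult_left_mono) auto
  finally show ?thesis by (simp add: algebra_simps)
qed

lemma \<delta>Q2_ge_1: "1 \<le> \<delta> * Q\<^sup>2"
proof -
  have "1 * 1 \<le> (\<delta> * Q) * Q" using \<delta>Q_ge_1 Q_ge_1 by (intro mult_mono) auto
  then show ?thesis by (simp add: power2_eq_square mult.assoc)
qed

text \<open>Points come from vertical lines, from blocks with at most two points, and from one line
  for each other block. There are at most l / L + 1 blocks, and the 1 is absorbed by \<delta> Q^2 >=
  1.\<close>

lemma card_P_le:
  assumes A: "0 < A"
    and dual_sum: "\<And>T. finite T \<Longrightarrow> T \<subseteq> near_tangents f f' b \<alpha> l Q A \<Longrightarrow>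
      (\<Sum>(s, t)\<in>T. 1 / real (den s t)) \<le> \<Sigma>"
  shows "real (card P) \<le>
    curve_const a b l * (\<delta> * Q\<^sup>2 + Q\<^sup>2 * sqrt (\<delta> / A) + Q * sqrt (Q * \<delta>) * \<Sigma>)"
proof -
  define L where "L = \<kappa> / (Q\<^sup>2 * \<delta>)"
  have L: "0 < L" unfolding L_def using \<kappa>_pos Q_pos \<delta>_pos by simp
  define P1 where "P1 = {p \<in> P. fst p \<notin> V}"
  have finP1: "finite P1" unfolding P1_def using finite_P by simp
  have inj: "inj_on fst P1"
  proof (rule inj_onI)
    fix p q assume pq: "p \<in> P1" "q \<in> P1" "fst p = fst q"
    show "p = q"
    proof (rule ccontr)
      assume "p \<noteq> q"
      then have ne: "snd p \<noteq> snd q" using pq by (simp add: prod_eq_iff)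
      have "(fst p, snd p) \<in> P" "(fst p, snd q) \<in> P"
        using pq(1,2) unfolding P1_def by (simp, simp add: pq(3))
      then have "{snd p, snd q} \<subseteq> Y (fst p)" unfolding Y_def by blast
      then have "card {snd p, snd q} \<le> card (Y (fst p))" by (rule card_mono[OF finite_Y])
      then have "fst p \<in> V" unfolding V_def using ne by simp
      then show False using pq unfolding P1_def by simp
    qed
  qed
  define idx where "idx p = \<lfloor>(fst p - \<alpha>) / L\<rfloor>" for p :: "real \<times> real"
  define B where "B i = {p \<in> P1. idx p = i}" for i
  define J where "J = {0..\<lfloor>l / L\<rfloor>}"
  define light heavy where "light = {i \<in> J. card (B i) \<le> 2}" and "heavy = {i \<in> J. 3 \<le> card (B i)}"
  have finJ: "finite J" "finite light" "finite heavy"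
  proof -
    show J: "finite J" unfolding J_def by simp
    show "finite light" "finite heavy" unfolding light_def heavy_def using J by simp_all
  qed
  have idx: "idx p \<in> J" if "p \<in> P1" for p
  proof -
    have "fst p \<in> {\<alpha>..\<alpha> + l}" using that mem_P[of "fst p" "snd p"] unfolding P1_def by simp
    then have "0 \<le> (fst p - \<alpha>) / L" "(fst p - \<alpha>) / L \<le> l / L" using L by (auto intro: divide_right_mono)
    then show ?thesis unfolding J_def idx_def by (simp add: floor_mono)
  qed
  define G where "G i p \<longleftrightarrow> 3 \<le> card (E (fst p) (snd p)) \<and> real (den (fst p) (snd p)) * \<delta> \<le> \<kappa> \<and>
      B i \<subseteq> (\<lambda>x. (x, fst p * x - snd p)) ` E (fst p) (snd p)" for i p
  have "\<exists>s t. 3 \<le> card (E s t) \<and> real (den s t) * \<delta> \<le> \<kappa> \<and> B i \<subseteq> (\<lambda>x. (x, s * x - t)) ` E s t"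
    if i: "i \<in> heavy" for i
  proof (rule block_on_line)
    show "B i \<subseteq> P" unfolding B_def P1_def by auto
    show "3 \<le> card (B i)" using i unfolding heavy_def by simp
    show "inj_on fst (B i)" by (rule inj_on_subset[OF inj]) (auto simp: B_def)
    fix p q assume "p \<in> B i" "q \<in> B i"
    then have "\<lfloor>(fst p - \<alpha>) / L\<rfloor> = \<lfloor>(fst q - \<alpha>) / L\<rfloor>" unfolding B_def idx_def by simp
    then have "\<bar>(fst p - \<alpha>) / L - (fst q - \<alpha>) / L\<bar> \<le> 1" by linarith
    then have "\<bar>(fst p - fst q) / L\<bar> \<le> 1" by (simp add: diff_divide_distrib)
    then show "\<bar>fst p - fst q\<bar> \<le> \<kappa> / (Q\<^sup>2 * \<delta>)" using L unfolding L_def[symmetric] by simp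
  qed
  then have ex: "\<exists>p. G i p" if "i \<in> heavy" for i
    using that unfolding G_def by simp
  then obtain p where p: "\<forall>i\<in>heavy. G i (p i)" using bchoice[of heavy G] by blast
  define s t where "s i = fst (p i)" and "t i = snd (p i)" for i
  have st: "3 \<le> card (E (s i) (t i))" "real (den (s i) (t i)) * \<delta> \<le> \<kappa>"
    "B i \<subseteq> (\<lambda>x. (x, s i * x - t i)) ` E (s i) (t i)" if "i \<in> heavy" for i
    using p that unfolding s_def t_def G_def by blast+
  \<comment> \<open>Taking a set of lines matters: a line chosen for several blocks is counted once,
    with all its near points.\<close>
  define \<L> where "\<L> = (\<lambda>i. (s i, t i)) ` heavy"
  have fin\<L>: "finite \<L>" unfolding \<L>_def using finJ by simp
  define U where "U = (\<Union>p\<in>\<L>. (\<lambda>x. (x, fst p * x - snd p)) ` E (fst p) (snd p))"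
  have "P1 \<subseteq> (\<Union>i\<in>light. B i) \<union> U"
  proof
    fix p assume p: "p \<in> P1"
    have "p \<in> B (idx p)" using p unfolding B_def by simp
    moreover have "idx p \<in> light \<or> idx p \<in> heavy" using idx[OF p] unfolding light_def heavy_def by auto
    moreover have "B i \<subseteq> U" if i: "i \<in> heavy" for i
    proof -
      have mem: "(s i, t i) \<in> \<L>" unfolding \<L>_def using i by blast
      have "(\<lambda>x. (x, s i * x - t i)) ` E (s i) (t i) \<subseteq> U" unfolding U_def
        using UN_upper[OF mem, of "\<lambda>p. (\<lambda>x. (x, fst p * x - snd p)) ` E (fst p) (snd p)"] by simp
      then show ?thesis using st(3)[OF i] by blast
    qed
    ultimately show "p \<in> (\<Union>i\<in>light. B i) \<union> U" by blast
  qed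
  moreover have "finite ((\<Union>i\<in>light. B i) \<union> U)"
    unfolding U_def using finJ fin\<L> finite_E finP1 by (auto simp: B_def)
  ultimately have "card P1 \<le> card ((\<Union>i\<in>light. B i) \<union> U)" by (intro card_mono)
  also have "\<dots> \<le> card (\<Union>i\<in>light. B i) + card U" by (rule card_Un_le)
  also have "card (\<Union>i\<in>light. B i) \<le> (\<Sum>i\<in>light. card (B i))" by (rule card_UN_le[OF finJ(2)])
  also have "(\<Sum>i\<in>light. card (B i)) \<le> (\<Sum>i\<in>light. 2)" by (rule sum_mono) (simp add: light_def)
  also have "(\<Sum>i\<in>light. 2) \<le> 2 * card J"
    using card_mono[OF finJ(1), of light] unfolding light_def by simp
  also have "card U \<le> (\<Sum>p\<in>\<L>. card (E (fst p) (snd p)))"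
    unfolding U_def by (rule order_trans[OF card_UN_le[OF fin\<L>] sum_mono]) (rule card_image_le[OF finite_E])
  finally have "real (card P1) \<le> real (2 * card J + (\<Sum>p\<in>\<L>. card (E (fst p) (snd p))))" by linarith
  then have P1: "real (card P1) \<le> 2 * real (card J) + (\<Sum>(s, t)\<in>\<L>. real (card (E s t)))"
    by (simp add: case_prod_beta)
  have cJ: "2 * real (card J) \<le> 2 * (l / \<kappa> + 1) * (\<delta> * Q\<^sup>2)"
  proof -
    have "0 \<le> l / L" using L l_nonneg by simp
    then have "real (card J) \<le> l / L + 1" unfolding J_def by simp
    also have "l / L = l / \<kappa> * (\<delta> * Q\<^sup>2)" unfolding L_def by simp
    also have "l / \<kappa> * (\<delta> * Q\<^sup>2) + 1 \<le> l / \<kappa> * (\<delta> * Q\<^sup>2) + \<delta> * Q\<^sup>2"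
      by (rule add_left_mono[OF \<delta>Q2_ge_1])
    finally have "2 * real (card J) \<le> 2 * (l / \<kappa> * (\<delta> * Q\<^sup>2) + \<delta> * Q\<^sup>2)"
      by (rule mult_left_mono) simp
    then show ?thesis by (simp only: distrib_right mult.assoc mult_1)
  qed
  have "P \<subseteq> P1 \<union> (SIGMA x:V. Y x)"
    unfolding P1_def Y_def by auto
  moreover have "finite (P1 \<union> (SIGMA x:V. Y x))" using finP1 finite_V finite_Y by auto
  ultimately have "card P \<le> card (P1 \<union> (SIGMA x:V. Y x))" by (intro card_mono)
  also have "\<dots> \<le> card P1 + card (SIGMA x:V. Y x)" by (rule card_Un_le)
  also have "card (SIGMA x:V. Y x) = (\<Sum>x\<in>V. card (Y x))" using finite_V finite_Y by simp
  finally have "real (card P) \<le> real (card P1 + (\<Sum>x\<in>V. card (Y x)))" by linarith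
  then have "real (card P) \<le> real (card P1) + (\<Sum>x\<in>V. real (card (Y x)))" by simp
  also have "\<dots> \<le> (2 * (l / \<kappa> + 1) * (\<delta> * Q\<^sup>2) + (16 * (l + 1) / (a * k) * (\<delta> * Q\<^sup>2)
      + 16 * (l + 1) / (k * sqrt a) * (Q\<^sup>2 * sqrt (\<delta> / A)) + 8 / sqrt a * (Q * sqrt (Q * \<delta>) * \<Sigma>)))
      + 8 * (l + 1) * (\<delta> * Q\<^sup>2)"
  proof (rule add_mono[OF order_trans[OF P1 add_mono[OF cJ]] sum_card_vertical])
    show "(\<Sum>(s, t)\<in>\<L>. real (card (E s t))) \<le> 16 * (l + 1) / (a * k) * (\<delta> * Q\<^sup>2)
      + 16 * (l + 1) / (k * sqrt a) * (Q\<^sup>2 * sqrt (\<delta> / A)) + 8 / sqrt a * (Q * sqrt (Q * \<delta>) * \<Sigma>)"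
      by (rule sum_card_lines[OF fin\<L> A _ dual_sum]) (use st in \<open>auto simp: \<L>_def\<close>)
  qed
  also have "\<dots> \<le> curve_const a b l * (\<delta> * Q\<^sup>2 + Q\<^sup>2 * sqrt (\<delta> / A) + Q * sqrt (Q * \<delta>) * \<Sigma>)"
  proof -
    define X Z W where "X = \<delta> * Q\<^sup>2" and "Z = Q\<^sup>2 * sqrt (\<delta> / A)" and "W = Q * sqrt (Q * \<delta>) * \<Sigma>"
    define c1 c2 c3 c4 c5 where "c1 = 2 * (l / \<kappa> + 1)" and "c2 = 8 * (l + 1)"
      and "c3 = 16 * (l + 1) / (a * k)" and "c4 = 16 * (l + 1) / (k * sqrt a)" and "c5 = 8 / sqrt a"
    have "0 \<le> \<Sigma>" using dual_sum[of "{}"] by simp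
    then have XZW: "0 \<le> X" "0 \<le> Z" "0 \<le> W" unfolding X_def Z_def W_def using \<delta>_pos Q_pos A by auto
    have c: "0 \<le> c1" "0 \<le> c2" "0 \<le> c3" "0 \<le> c4" "0 \<le> c5"
      unfolding c1_def c2_def c3_def c4_def c5_def using l_nonneg a_pos k_pos \<kappa>_pos by auto
    have "(c1 * X + (c3 * X + c4 * Z + c5 * W)) + c2 * X = (c1 + c2 + c3) * X + c4 * Z + c5 * W"
      by (simp add: algebra_simps)
    also have "\<dots> \<le> (c1 + c2 + c3 + c4 + c5) * X + (c1 + c2 + c3 + c4 + c5) * Z + (c1 + c2 + c3 + c4 + c5) * W"
      by (rule add_mono[OF add_mono]; rule mult_right_mono; use XZW c in linarith)
    finally show ?thesis
      unfolding curve_const_def c1_def[symmetric] c2_def[symmetric] c3_def[symmetric] c4_def[symmetric]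
        c5_def[symmetric] X_def[symmetric] Z_def[symmetric] W_def[symmetric]
      by (simp add: distrib_left)
  qed
  finally show ?thesis .
qed

end

section \<open>Bootstrapping through the dual curve\<close>

text \<open>The i-th dyadic range contributes at most C r^i with r = 2 powr \<sigma>. The geometric
  series is dominated by its end, and r^n <= r A^\<sigma> for the least n with 2^n >= A.\<close>

lemma dyadic_reciprocal_sum:
  fixes d :: "'a \<Rightarrow> nat" and C \<sigma> A :: real
  assumes fin: "finite T" and pos: "\<And>p. p \<in> T \<Longrightarrow> 0 < d p" and lt: "\<And>p. p \<in> T \<Longrightarrow> real (d p) < A"
    and cnt: "\<And>i. real (card {p \<in> T. 2 ^ i \<le> d p \<and> d p < 2 ^ Suc i}) \<le> C * 2 ^ i * (2 powr \<sigma>) ^ i"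
    and \<sigma>: "0 < \<sigma>" and C: "0 < C" and A: "0 < A"
  shows "(\<Sum>p\<in>T. 1 / real (d p)) \<le> C * 2 powr \<sigma> / (2 powr \<sigma> - 1) * A powr \<sigma>"
proof (cases "A \<le> 1")
  case True
  then have "T = {}" using pos lt by force
  moreover have "1 < 2 powr \<sigma>" using \<sigma> by simp
  ultimately show ?thesis using C by (auto intro!: divide_nonneg_pos mult_nonneg_nonneg)
next
  case False
  define r :: real where "r = 2 powr \<sigma>"
  have r: "1 < r" unfolding r_def using \<sigma> by simp
  have step: "(\<Sum>p | p \<in> T \<and> d p < 2 ^ n. 1 / real (d p)) \<le> C * r ^ n / (r - 1)" for n
  proof (induction n)
    case 0
    have "{p \<in> T. d p < 2 ^ 0} = {}" using pos by force
    then show ?case using C r by simp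
  next
    case (Suc n)
    have split: "{p \<in> T. d p < 2 ^ Suc n} = {p \<in> T. d p < 2 ^ n} \<union> {p \<in> T. 2 ^ n \<le> d p \<and> d p < 2 ^ Suc n}"
      (is "_ = ?A \<union> ?B") by auto
    have "(\<Sum>p\<in>?B. 1 / real (d p)) \<le> (\<Sum>p\<in>?B. 1 / 2 ^ n)"
    proof (rule sum_mono)
      fix p assume p: "p \<in> ?B"
      then have "real (2 ^ n) \<le> real (d p)" by (subst of_nat_le_iff) simp
      then show "1 / real (d p) \<le> 1 / 2 ^ n" using pos[of p] p by (intro divide_left_mono) auto
    qed
    also have "\<dots> = real (card ?B) / 2 ^ n" by simp
    also have "\<dots> \<le> C * 2 ^ n * r ^ n / 2 ^ n"
      unfolding r_def by (intro divide_right_mono cnt) simp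
    finally have B: "(\<Sum>p\<in>?B. 1 / real (d p)) \<le> C * r ^ n" by simp
    have "(\<Sum>p\<in>?A \<union> ?B. 1 / real (d p)) = (\<Sum>p\<in>?A. 1 / real (d p)) + (\<Sum>p\<in>?B. 1 / real (d p))"
      using fin by (intro sum.union_disjoint) auto
    also have "\<dots> \<le> C * r ^ n / (r - 1) + C * r ^ n" by (rule add_mono[OF Suc.IH B])
    also have "\<dots> = C * r ^ Suc n / (r - 1)" using r by (simp add: field_simps)
    finally show ?case unfolding split .
  qed
  define n where "n = nat \<lceil>log 2 A\<rceil>"
  have lA: "0 \<le> log 2 A" using False by simp
  have n: "log 2 A \<le> real n" "real n \<le> log 2 A + 1" unfolding n_def using lA by linarith+
  have "A = 2 powr (log 2 A)" using A by simp
  also have "\<dots> \<le> 2 powr (real n)" using n(1) by simp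
  finally have An: "A \<le> 2 ^ n" by (simp add: powr_realpow)
  have "d p < 2 ^ n" if "p \<in> T" for p
  proof -
    have "real (d p) < 2 ^ n" using lt[OF that] An by linarith
    then show ?thesis by (metis of_nat_less_iff of_nat_numeral of_nat_power)
  qed
  then have "{p \<in> T. d p < 2 ^ n} = T" by auto
  then have "(\<Sum>p\<in>T. 1 / real (d p)) \<le> C * r ^ n / (r - 1)" using step[of n] by simp
  also have "\<dots> \<le> C * (r * A powr \<sigma>) / (r - 1)"
  proof -
    have "r ^ n = 2 powr (\<sigma> * real n)" unfolding r_def by (simp add: powr_realpow[symmetric] powr_powr)
    also have "\<dots> \<le> 2 powr (\<sigma> + log 2 A * \<sigma>)"
      using mult_left_mono[OF n(2), of \<sigma>] \<sigma> by (simp add: algebra_simps)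
    also have "\<dots> = r * A powr \<sigma>"
      using A by (simp add: powr_add r_def powr_powr[symmetric])
    finally show ?thesis using C r by (intro divide_right_mono mult_left_mono) auto
  qed
  finally show ?thesis unfolding r_def by (simp add: mult_ac)
qed

text \<open>This is the critical scale \<delta> = K / Q. C is chosen before f and \<alpha> because
  the bound is applied to all dual curves; K is arbitrary because passing to the dual replaces it by
  a constant depending on b.\<close>

definition count_exponent :: "real \<Rightarrow> bool" where
  "count_exponent \<sigma> \<longleftrightarrow> (\<forall>a b l K. 0 < a \<longrightarrow> a \<le> b \<longrightarrow> 0 \<le> l \<longrightarrow> 1 \<le> K \<longrightarrow>
     (\<exists>C>0. \<forall>f f' \<alpha> Q. pinched a b f f' \<longrightarrow> 1 \<le> Q \<longrightarrow>
        real (card (near_points f Q (\<lambda>_. K / Q) {\<alpha>..\<alpha> + l})) \<le> C * Q powr (1 + \<sigma>)))"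

text \<open>Lines of height h in [2^i, 2^(i+1)) are near points of the dual curve for R = 2^(i+1):
  from 2^i <= h < A <= Q follows 1/(h Q) <= 4 / R^2. The ranges are then added up
  dyadically.\<close>

lemma near_tangents_sum:
  assumes ce: "count_exponent \<sigma>" and \<sigma>: "0 < \<sigma>" and ab: "0 < a" "a \<le> b" and l: "0 \<le> l"
  shows "\<exists>C>0. \<forall>f f' \<alpha> Q A T. pinched a b f f' \<longrightarrow> 1 \<le> Q \<longrightarrow> 0 < A \<longrightarrow> A \<le> Q \<longrightarrow> finite T \<longrightarrow>
    T \<subseteq> near_tangents f f' b \<alpha> l Q A \<longrightarrow> (\<Sum>(s, t)\<in>T. 1 / real (den s t)) \<le> C * A powr \<sigma>"
proof -
  \<comment> \<open>The 4 stems from 2^i 2^i = R^2 / 4; the added 1 makes the inequality strict, as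
    near points require.\<close>
  define K where "K = 4 * (1 + b) + 1"
  have b: "0 < b" using ab by simp
  have ab': "0 < a / b\<^sup>2" "a / b\<^sup>2 \<le> b / a\<^sup>2" "0 \<le> b * (l + 2)" "1 \<le> K"
  proof -
    have "a * a\<^sup>2 \<le> b * b\<^sup>2" using ab by (intro mult_mono power_mono) auto
    then show "a / b\<^sup>2 \<le> b / a\<^sup>2" using ab b by (simp add: field_simps)
  qed (use ab b l in \<open>auto simp: K_def\<close>)
  obtain C where C: "0 < C" and cnt: "\<And>f f' \<alpha> Q. pinched (a / b\<^sup>2) (b / a\<^sup>2) f f' \<Longrightarrow> 1 \<le> Q \<Longrightarrow>
        real (card (near_points f Q (\<lambda>_. K / Q) {\<alpha>..\<alpha> + b * (l + 2)})) \<le> C * Q powr (1 + \<sigma>)"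
    using ce[unfolded count_exponent_def, rule_format, OF ab'] by blast
  define C' where "C' = C * 2 powr (1 + \<sigma>)"
  have C': "0 < C'" unfolding C'_def using C by simp
  define C'' where "C'' = C' * 2 powr \<sigma> / (2 powr \<sigma> - 1)"
  have "0 < C''" unfolding C''_def using C' \<sigma> by simp
  moreover have "(\<Sum>(s, t)\<in>T. 1 / real (den s t)) \<le> C'' * A powr \<sigma>"
    if p: "pinched a b f f'" and Q: "1 \<le> Q" and A: "0 < A" "A \<le> Q" and T: "finite T"
      "T \<subseteq> near_tangents f f' b \<alpha> l Q A" for f f' \<alpha> Q A T
  proof -
    define d where "d p = den (fst p) (snd p)" for p
    have "(\<Sum>p\<in>T. 1 / real (d p)) \<le> C'' * A powr \<sigma>"
      unfolding C''_def
    proof (rule dyadic_reciprocal_sum[OF T(1) _ _ _ \<sigma> C' A(1)])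
      have mem: "\<exists>n>0. real n * fst p \<in> \<int> \<and> real n * snd p \<in> \<int>" "real (d p) < A"
          "fst p \<in> {f' (\<alpha> - 1)..f' (\<alpha> - 1) + b * (l + 2)}"
          "\<bar>dual f f' (fst p) - snd p\<bar> \<le> (1 + b) / (real (d p) * Q)" if "p \<in> T" for p
        using subsetD[OF T(2) that] unfolding near_tangents_def d_def by (simp_all add: case_prod_beta)
      show lt: "real (d p) < A" if "p \<in> T" for p by (rule mem(2)[OF that])
      have dp: "0 < d p" "real (d p) * fst p \<in> \<int>" "real (d p) * snd p \<in> \<int>" if "p \<in> T" for p
        using mem(1)[OF that] den_pos[of _ "fst p" "snd p"] den_fst[of _ "fst p" "snd p"]
          den_snd[of _ "fst p" "snd p"] unfolding d_def by auto
      show "0 < d p" if "p \<in> T" for p by (rule dp(1)[OF that])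
      fix i :: nat
      define R :: real where "R = 2 ^ Suc i"
      have R: "1 \<le> R" unfolding R_def by (rule one_le_power) simp
      have "{p \<in> T. 2 ^ i \<le> d p \<and> d p < 2 ^ Suc i} \<subseteq>
        near_points (dual f f') R (\<lambda>_. K / R) {f' (\<alpha> - 1)..f' (\<alpha> - 1) + b * (l + 2)}"
      proof
        fix p assume "p \<in> {p \<in> T. 2 ^ i \<le> d p \<and> d p < 2 ^ Suc i}"
        then have pT: "p \<in> T" and lo: "2 ^ i \<le> d p" and hi: "d p < 2 ^ Suc i" by auto
        have lo': "2 ^ i \<le> real (d p)" using lo by (metis of_nat_le_iff of_nat_numeral of_nat_power)
        have hi': "real (d p) \<le> R" unfolding R_def using hi
          by (metis less_imp_le of_nat_le_iff of_nat_numeral of_nat_power)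
        have Qi: "2 ^ i \<le> Q" using lo' lt[OF pT] A by linarith
        have "\<bar>dual f f' (fst p) - snd p\<bar> \<le> (1 + b) / (real (d p) * Q)" by (rule mem(4)[OF pT])
        also have "\<dots> \<le> (1 + b) / (2 ^ i * 2 ^ i)"
          using lo' Qi b by (intro divide_left_mono mult_mono mult_pos_pos) (auto intro: less_le_trans[of 0 "2 ^ i"])
        also have "\<dots> = 4 * (1 + b) / R / R" unfolding R_def by (simp add: field_simps)
        also have "\<dots> < K / R / R" unfolding K_def using R by (intro divide_strict_right_mono) auto
        finally have "\<bar>dual f f' (fst p) - snd p\<bar> < K / R / R" .
        moreover have "rational_upto R (fst p, snd p)"
          unfolding rational_upto_def using dp[OF pT] hi' by (intro exI[of _ "d p"]) auto
        ultimately have "(fst p, snd p) \<in> near_points (dual f f') R (\<lambda>_. K / R) {f' (\<alpha> - 1)..f' (\<alpha> - 1) + b * (l + 2)}"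
          unfolding near_points_iff using mem(3)[OF pT] by simp
        then show "p \<in> near_points (dual f f') R (\<lambda>_. K / R) {f' (\<alpha> - 1)..f' (\<alpha> - 1) + b * (l + 2)}" by simp
      qed
      then have "real (card {p \<in> T. 2 ^ i \<le> d p \<and> d p < 2 ^ Suc i}) \<le>
        real (card (near_points (dual f f') R (\<lambda>_. K / R) {f' (\<alpha> - 1)..f' (\<alpha> - 1) + b * (l + 2)}))"
        by (intro of_nat_mono card_mono finite_near_points) auto
      also have "\<dots> \<le> C * R powr (1 + \<sigma>)" by (rule cnt[OF pinched_dual[OF p ab(1) b] R])
      also have "R powr (1 + \<sigma>) = 2 powr (1 + \<sigma>) * 2 ^ i * (2 powr \<sigma>) ^ i"
      proof -
        have "R = 2 powr (1 + real i)" unfolding R_def by (simp add: powr_add powr_realpow)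
        then have "R powr (1 + \<sigma>) = 2 powr ((1 + \<sigma>) + real i + \<sigma> * real i)"
          by (simp add: powr_powr algebra_simps)
        also have "\<dots> = 2 powr (1 + \<sigma>) * 2 powr (real i) * (2 powr \<sigma>) powr (real i)"
          by (simp only: powr_add powr_powr)
        finally show ?thesis by (simp add: powr_realpow)
      qed
      finally show "real (card {p \<in> T. 2 ^ i \<le> d p \<and> d p < 2 ^ Suc i}) \<le> C' * 2 ^ i * (2 powr \<sigma>) ^ i"
        unfolding C'_def by (simp add: mult_ac)
    qed
    then show ?thesis unfolding d_def by (simp add: case_prod_beta)
  qed
  ultimately show ?thesis by blast
qed

section \<open>Induction on the exponent\<close>

lemma curve_const_pos:
  assumes "0 < a" "a \<le> b" "0 \<le> l"
  shows "0 < curve_const a b l"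
proof -
  have k: "0 < zone_const b" unfolding zone_const_def using assms by auto
  then have "0 < block_const a b" unfolding block_const_def using assms by auto
  then show ?thesis unfolding curve_const_def using assms k by (intro add_nonneg_pos add_nonneg_nonneg) auto
qed

lemma near_tangents_1: "near_tangents f f' b \<alpha> l Q 1 = {}"
proof -
  have "\<not> real (den s t) < 1" if ex: "\<exists>n>0. real n * s \<in> \<int> \<and> real n * t \<in> \<int>" for s t
  proof -
    obtain n where "n > 0" "real n * s \<in> \<int>" "real n * t \<in> \<int>" using ex by blast
    then have "0 < den s t" by (rule den_pos)
    then show ?thesis by simp
  qed
  then show ?thesis unfolding near_tangents_def by blast
qed

text \<open>A = 1 leaves nothing to the dual curve, since heights are at least 1. The other terms
  are O(Q^(3/2)), more than enough for exponent 2.\<close>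

lemma count_exponent_1: "count_exponent 1"
  unfolding count_exponent_def
proof (intro allI impI)
  fix a b l K :: real
  assume ab: "0 < a" "a \<le> b" "0 \<le> l" and K: "1 \<le> K"
  define C where "C = curve_const a b l * (2 * K)"
  have "0 < C" unfolding C_def using curve_const_pos[OF ab] K by simp
  moreover have "real (card (near_points f Q (\<lambda>_. K / Q) {\<alpha>..\<alpha> + l})) \<le> C * Q powr (1 + 1)"
    if p: "pinched a b f f'" and Q: "1 \<le> Q" for f f' \<alpha> Q
  proof -
    interpret near_curve f f' a b \<alpha> l Q "K / Q"
      using p ab K Q by unfold_locales auto
    have "real (card P) \<le> curve_const a b l *
        (K / Q * Q\<^sup>2 + Q\<^sup>2 * sqrt (K / Q / 1) + Q * sqrt (Q * (K / Q)) * 0)"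
      by (rule card_P_le) (auto simp: near_tangents_1)
    also have "\<dots> \<le> curve_const a b l * (K * Q\<^sup>2 + Q\<^sup>2 * K)"
    proof (intro mult_left_mono)
      have 1: "K / Q \<le> K / 1" using K Q by (intro divide_left_mono) auto
      have "sqrt (K / Q / 1) \<le> sqrt (K\<^sup>2)"
      proof (rule real_sqrt_le_mono)
        have "K * 1 \<le> K\<^sup>2" unfolding power2_eq_square using K by (intro mult_left_mono) auto
        then show "K / Q / 1 \<le> K\<^sup>2" using 1 by simp
      qed
      then have "Q\<^sup>2 * sqrt (K / Q / 1) \<le> Q\<^sup>2 * K" using K by (intro mult_left_mono) auto
      moreover have "K / Q * Q\<^sup>2 \<le> K * Q\<^sup>2" using 1 by (intro mult_right_mono) auto
      ultimately have "K / Q * Q\<^sup>2 + Q\<^sup>2 * sqrt (K / Q / 1) \<le> K * Q\<^sup>2 + Q\<^sup>2 * K"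
        by (intro add_mono)
      then show "K / Q * Q\<^sup>2 + Q\<^sup>2 * sqrt (K / Q / 1) + Q * sqrt (Q * (K / Q)) * 0 \<le> K * Q\<^sup>2 + Q\<^sup>2 * K"
        by (simp only: mult_zero_right add_0_right)
    qed (use curve_const_pos[OF ab] in simp)
    finally show ?thesis unfolding P_def C_def using Q by (simp add: mult_ac)
  qed
  ultimately show "\<exists>C>0. \<forall>f f' \<alpha> Q. pinched a b f f' \<longrightarrow> 1 \<le> Q \<longrightarrow>
        real (card (near_points f Q (\<lambda>_. K / Q) {\<alpha>..\<alpha> + l})) \<le> C * Q powr (1 + 1)" by blast
qed

text \<open>\<tau> is the solution of \<tau> = (1 - \<tau>) \<sigma>. With A = Q^(1 - \<tau>) the
  dual term Q A^\<sigma> becomes Q^(1 + \<tau>), and the zone term Q^(3/2) / sqrt A becomes Q^(1 +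
  \<tau>/2).\<close>

lemma count_exponent_step:
  assumes ce: "count_exponent \<sigma>" and \<sigma>: "0 < \<sigma>"
  shows "count_exponent (\<sigma> / (1 + \<sigma>))"
  unfolding count_exponent_def
proof (intro allI impI)
  fix a b l K :: real
  assume ab: "0 < a" "a \<le> b" "0 \<le> l" and K: "1 \<le> K"
  define \<tau> where "\<tau> = \<sigma> / (1 + \<sigma>)"
  have \<tau>: "0 < \<tau>" "\<tau> < 1" "\<tau> = (1 - \<tau>) * \<sigma>"
    unfolding \<tau>_def using \<sigma> by (auto simp: field_simps)
  obtain C where C: "0 < C" and sum: "\<And>f f' \<alpha> Q A T. pinched a b f f' \<Longrightarrow> 1 \<le> Q \<Longrightarrow> 0 < A \<Longrightarrow> A \<le> Q \<Longrightarrow>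
    finite T \<Longrightarrow> T \<subseteq> near_tangents f f' b \<alpha> l Q A \<Longrightarrow> (\<Sum>(s, t)\<in>T. 1 / real (den s t)) \<le> C * A powr \<sigma>"
    using near_tangents_sum[OF ce \<sigma> ab] by blast
  define C' where "C' = curve_const a b l * (K + K + K * C)"
  have "0 < C'" unfolding C'_def using curve_const_pos[OF ab] K C by (intro mult_pos_pos add_pos_pos) auto
  moreover have "real (card (near_points f Q (\<lambda>_. K / Q) {\<alpha>..\<alpha> + l})) \<le> C' * Q powr (1 + \<tau>)"
    if p: "pinched a b f f'" and Q: "1 \<le> Q" for f f' \<alpha> Q
  proof -
    interpret near_curve f f' a b \<alpha> l Q "K / Q"
      using p ab K Q by unfold_locales auto
    have sK: "sqrt K \<le> K" using K by (simp add: real_sqrt_le_iff' power2_eq_square)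
    define A where "A = Q powr (1 - \<tau>)"
    have A0: "0 < A" unfolding A_def using Q by simp
    have "Q powr (1 - \<tau>) \<le> Q powr 1" using Q \<tau> by (intro powr_mono) auto
    then have AQ: "A \<le> Q" unfolding A_def using Q by simp
    have "real (card P) \<le> curve_const a b l *
        (K / Q * Q\<^sup>2 + Q\<^sup>2 * sqrt (K / Q / A) + Q * sqrt (Q * (K / Q)) * (C * A powr \<sigma>))"
      by (rule card_P_le[OF A0]) (rule sum[OF p Q A0 AQ])
    also have "\<dots> \<le> curve_const a b l *
        (K * Q powr (1 + \<tau>) + K * Q powr (1 + \<tau>) + (K * C) * Q powr (1 + \<tau>))"
    proof (intro mult_left_mono add_mono)
      have "Q powr 1 \<le> Q powr (1 + \<tau>)" using Q \<tau> by (intro powr_mono) auto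
      then show "K / Q * Q\<^sup>2 \<le> K * Q powr (1 + \<tau>)" using K Q by (simp add: power2_eq_square)
      have "sqrt (K / Q / A) = sqrt K * Q powr (\<tau> / 2 - 1)"
      proof -
        have "1 / Q / A = Q powr (\<tau> - 2)"
        proof -
          have "1 / Q / A = Q powr (-1) * Q powr (- (1 - \<tau>))"
            unfolding A_def powr_minus_divide using Q by simp
          also have "\<dots> = Q powr (-1 + - (1 - \<tau>))" by (rule powr_add[symmetric])
          finally show ?thesis by simp
        qed
        also have "\<dots> = (Q powr (\<tau> / 2 - 1))\<^sup>2"
          using Q by (simp add: power2_eq_square powr_add[symmetric])
        finally have "sqrt (1 / Q / A) = Q powr (\<tau> / 2 - 1)" by simp
        moreover have "K / Q / A = K * (1 / Q / A)" by simp
        ultimately show ?thesis by (simp only: real_sqrt_mult)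
      qed
      also have "Q\<^sup>2 * (sqrt K * Q powr (\<tau> / 2 - 1)) = sqrt K * (Q powr 2 * Q powr (\<tau> / 2 - 1))"
        using Q by simp
      also have "\<dots> = sqrt K * Q powr (1 + \<tau> / 2)" by (simp add: powr_add[symmetric])
      also have "\<dots> \<le> K * Q powr (1 + \<tau>)"
        using sK K Q \<tau> by (intro mult_mono powr_mono) auto
      finally show "Q\<^sup>2 * sqrt (K / Q / A) \<le> K * Q powr (1 + \<tau>)" .
      have "A powr \<sigma> = Q powr \<tau>" unfolding A_def powr_powr using \<tau>(3) by simp
      then have "Q * sqrt (Q * (K / Q)) * (C * A powr \<sigma>) = sqrt K * (C * (Q powr 1 * Q powr \<tau>))"
        using Q by simp
      also have "\<dots> = sqrt K * (C * Q powr (1 + \<tau>))" by (simp only: powr_add)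
      also have "\<dots> \<le> K * (C * Q powr (1 + \<tau>))" using sK C by (intro mult_right_mono) auto
      finally show "Q * sqrt (Q * (K / Q)) * (C * A powr \<sigma>) \<le> (K * C) * Q powr (1 + \<tau>)"
        by (simp only: mult.assoc)
    qed (use curve_const_pos[OF ab] in simp)
    finally show ?thesis unfolding P_def C'_def by (simp add: algebra_simps)
  qed
  ultimately show "\<exists>C>0. \<forall>f f' \<alpha> Q. pinched a b f f' \<longrightarrow> 1 \<le> Q \<longrightarrow>
        real (card (near_points f Q (\<lambda>_. K / Q) {\<alpha>..\<alpha> + l})) \<le> C * Q powr (1 + \<sigma> / (1 + \<sigma>))"
    unfolding \<tau>_def by blast
qed

text \<open>Each step adds 1 to the reciprocal of the exponent.\<close>

lemma count_exponent_inverse: "count_exponent (1 / real (Suc n))"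
proof (induction n)
  case 0
  then show ?case using count_exponent_1 by simp
next
  case (Suc n)
  have "1 / real (Suc n) / (1 + 1 / real (Suc n)) = 1 / real (Suc (Suc n))"
    by (simp add: field_simps)
  then show ?case using count_exponent_step[OF Suc.IH] by simp
qed

text \<open>With A = 1/\<delta> the zone term is \<delta> Q^2. The dual term Q sqrt(Q \<delta>)
  \<delta>^(-\<sigma>) is at most \<delta> Q^2 when \<delta>^(-1/2 - \<sigma>) <= sqrt Q, and this
  follows from \<delta> >= Q^(-\<phi>) once \<phi> (1 + 2 \<sigma>) <= 1. As \<phi> < 1, a small
  \<sigma> achieves it.\<close>

lemma near_points_pinched:
  assumes ab: "0 < a" "a \<le> b" and l: "0 \<le> l" and \<phi>: "0 \<le> \<phi>" "\<phi> < 1"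
  shows "\<exists>C>0. \<forall>f f' \<alpha> Q \<delta>. pinched a b f f' \<longrightarrow> 1 \<le> Q \<longrightarrow> Q powr (- \<phi>) \<le> \<delta> \<longrightarrow>
    real (card (near_points f Q (\<lambda>_. \<delta>) {\<alpha>..\<alpha> + l})) \<le> C * (\<delta> * Q\<^sup>2)"
proof -
  \<comment> \<open>Ensures 2 \<sigma> <= 1 - \<phi>, whence \<phi> + 2 \<sigma> \<phi> <= \<phi> +
    2 \<sigma> <= 1.\<close>
  obtain n where n: "2 / (1 - \<phi>) < real (Suc n)" using reals_Archimedean2
    by (metis less_trans lessI of_nat_less_iff)
  define \<sigma> where "\<sigma> = 1 / real (Suc n)"
  have \<sigma>0: "0 < \<sigma>" unfolding \<sigma>_def by simp
  have "2 < real (Suc n) * (1 - \<phi>)" using n \<phi> by (simp add: pos_divide_less_eq)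
  then have "2 * \<sigma> \<le> 1 - \<phi>" unfolding \<sigma>_def by (simp add: divide_le_eq mult.commute)
  moreover have "\<phi> * (2 * \<sigma>) \<le> 1 * (2 * \<sigma>)" using \<phi> \<sigma>0 by (intro mult_right_mono) auto
  ultimately have \<sigma>: "\<phi> * (1 + 2 * \<sigma>) \<le> 1" by (simp add: distrib_left)
  obtain C where C: "0 < C" and sum: "\<And>f f' \<alpha> Q A T. pinched a b f f' \<Longrightarrow> 1 \<le> Q \<Longrightarrow> 0 < A \<Longrightarrow> A \<le> Q \<Longrightarrow>
    finite T \<Longrightarrow> T \<subseteq> near_tangents f f' b \<alpha> l Q A \<Longrightarrow> (\<Sum>(s, t)\<in>T. 1 / real (den s t)) \<le> C * A powr \<sigma>"
    using near_tangents_sum[OF count_exponent_inverse[of n, folded \<sigma>_def] \<sigma>0 ab l] by blast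
  define C' where "C' = curve_const a b l * (2 + C)"
  have "0 < C'" unfolding C'_def using curve_const_pos[OF ab l] C by simp
  moreover have "real (card (near_points f Q (\<lambda>_. \<delta>) {\<alpha>..\<alpha> + l})) \<le> C' * (\<delta> * Q\<^sup>2)"
    if p: "pinched a b f f'" and Q: "1 \<le> Q" and \<delta>: "Q powr (- \<phi>) \<le> \<delta>" for f f' \<alpha> Q \<delta>
  proof -
    have \<delta>0: "0 < \<delta>" using less_le_trans[OF _ \<delta>] Q by simp
    have inv: "1 / \<delta> \<le> Q powr \<phi>"
    proof -
      have "1 / \<delta> \<le> 1 / Q powr (- \<phi>)" using \<delta> \<delta>0 Q by (intro divide_left_mono) auto
      then show ?thesis by (simp add: powr_minus_divide)
    qed
    also have "\<dots> \<le> Q powr 1" using Q \<phi> by (intro powr_mono) auto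
    finally have AQ: "1 / \<delta> \<le> Q" using Q by simp
    interpret near_curve f f' a b \<alpha> l Q \<delta>
      using p ab l Q AQ \<delta>0 by unfold_locales (auto simp: field_simps)
    have "real (card P) \<le> curve_const a b l *
        (\<delta> * Q\<^sup>2 + Q\<^sup>2 * sqrt (\<delta> / (1 / \<delta>)) + Q * sqrt (Q * \<delta>) * (C * (1 / \<delta>) powr \<sigma>))"
      by (rule card_P_le) (use \<delta>0 sum[OF p Q _ AQ] in auto)
    also have "\<dots> \<le> curve_const a b l * (\<delta> * Q\<^sup>2 + \<delta> * Q\<^sup>2 + C * (\<delta> * Q\<^sup>2))"
    proof (intro mult_left_mono add_mono)
      show "Q\<^sup>2 * sqrt (\<delta> / (1 / \<delta>)) \<le> \<delta> * Q\<^sup>2" using \<delta>0 by simp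
      have "sqrt (1 / \<delta>) * (1 / \<delta>) powr \<sigma> = (1 / \<delta>) powr (1 / 2 + \<sigma>)"
        using \<delta>0 by (simp only: powr_add) (simp add: powr_half_sqrt)
      also have "\<dots> \<le> (Q powr \<phi>) powr (1 / 2 + \<sigma>)"
        using inv \<delta>0 \<sigma>0 by (intro powr_mono2) auto
      also have "\<dots> = Q powr (\<phi> * (1 / 2 + \<sigma>))" by (rule powr_powr)
      also have "\<dots> \<le> Q powr (1 / 2)" using Q \<sigma> by (intro powr_mono) (auto simp: algebra_simps)
      also have "\<dots> = sqrt Q" using Q by (simp add: powr_half_sqrt)
      finally have key: "sqrt (1 / \<delta>) * (1 / \<delta>) powr \<sigma> \<le> sqrt Q" .
      have "sqrt \<delta> = \<delta> * sqrt (1 / \<delta>)" using \<delta>0 by (simp add: real_sqrt_divide real_div_sqrt)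
      then have "Q * sqrt (Q * \<delta>) * (C * (1 / \<delta>) powr \<sigma>)
          = C * (Q * (\<delta> * sqrt Q)) * (sqrt (1 / \<delta>) * (1 / \<delta>) powr \<sigma>)"
        unfolding real_sqrt_mult by simp
      also have "\<dots> \<le> C * (Q * (\<delta> * sqrt Q)) * sqrt Q"
        using key C Q \<delta>0 by (intro mult_left_mono) auto
      also have "\<dots> = C * (\<delta> * (Q * (sqrt Q * sqrt Q)))" by simp
      also have "\<dots> = C * (\<delta> * Q\<^sup>2)" using Q by (simp add: power2_eq_square)
      finally show "Q * sqrt (Q * \<delta>) * (C * (1 / \<delta>) powr \<sigma>) \<le> C * (\<delta> * Q\<^sup>2)" .
    qed (use curve_const_pos[OF ab l] C \<delta>0 in auto)
    finally show ?thesis unfolding P_def C'_def by (simp add: algebra_simps)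
  qed
  ultimately show ?thesis by blast
qed

section \<open>Curves on an interval\<close>

text \<open>Reflection in the horizontal axis preserves denominators; it reduces negative curvature
  to positive curvature.\<close>

lemma card_near_points_uminus:
  "card (near_points (\<lambda>x. - f x) Q \<psi> S) = card (near_points f Q \<psi> S)"
proof -
  have r: "rational_upto Q (x, - y) \<longleftrightarrow> rational_upto Q (x, y)" for x y
    unfolding rational_upto_def by simp
  have m: "(x, - y) \<in> near_points f Q \<psi> S \<longleftrightarrow> (x, y) \<in> near_points (\<lambda>x. - f x) Q \<psi> S" for x y
    unfolding near_points_iff r by (auto simp: abs_minus_commute)
  have "bij_betw (\<lambda>(x, y). (x, - y)) (near_points (\<lambda>x. - f x) Q \<psi> S) (near_points f Q \<psi> S)"
    by (rule bij_betw_byWitness[where f' = "\<lambda>(x, y). (x, - y)"])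
      (auto simp flip: m)
  then show ?thesis by (rule bij_betw_same_card)
qed

lemma near_points_cong:
  assumes "\<And>x. x \<in> S \<Longrightarrow> f x = g x" "\<psi> Q = \<delta>"
  shows "near_points f Q \<psi> S = near_points g Q (\<lambda>_. \<delta>) S"
proof -
  have "(x, y) \<in> near_points f Q \<psi> S \<longleftrightarrow> (x, y) \<in> near_points g Q (\<lambda>_. \<delta>) S" for x y
    unfolding near_points_iff assms(2) using assms(1) by auto
  then show ?thesis by (intro set_eqI) (metis surj_pair)
qed

lemma N_count_pos_curvature:
  fixes f f' f'' \<psi> :: "real \<Rightarrow> real"
  assumes le: "\<eta> \<le> \<xi>"
    and f: "\<And>x. x \<in> {\<eta>..\<xi>} \<Longrightarrow> (f has_real_derivative f' x) (at x within {\<eta>..\<xi>})"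
    and f': "\<And>x. x \<in> {\<eta>..\<xi>} \<Longrightarrow> (f' has_real_derivative f'' x) (at x within {\<eta>..\<xi>})"
    and bnd: "0 < a" "a \<le> b" "\<And>x. x \<in> {\<eta>..\<xi>} \<Longrightarrow> a \<le> f'' x \<and> f'' x \<le> b"
    and \<phi>: "\<phi> < 1" and \<psi>: "\<And>Q. 1 \<le> Q \<Longrightarrow> Q powr (- \<phi>) \<le> \<psi> Q"
  shows "\<exists>C>0. \<forall>Q\<ge>1. real (N_count f Q \<psi> {\<eta>..\<xi>}) \<le> C * (\<psi> Q * Q\<^sup>2)"
proof -
  obtain h h' where h: "pinched a b h h'" "\<forall>x\<in>{\<eta>..\<xi>}. h x = f x"
    using pinched_extension[OF pinched_on_interval[OF f f' bnd(3)] le bnd(2)] by blast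
  \<comment> \<open>\<phi> may be negative; raising it to 0 only weakens the lower bound on \<psi>,
    as Q >= 1.\<close>
  define \<phi>' where "\<phi>' = max 0 \<phi>"
  have \<phi>': "0 \<le> \<phi>'" "\<phi>' < 1" unfolding \<phi>'_def using \<phi> by auto
  have "0 \<le> \<xi> - \<eta>" using le by simp
  then obtain C where C: "0 < C" and cnt: "\<And>f f' \<alpha> Q \<delta>. pinched a b f f' \<Longrightarrow> 1 \<le> Q \<Longrightarrow> Q powr (- \<phi>') \<le> \<delta> \<Longrightarrow>
    real (card (near_points f Q (\<lambda>_. \<delta>) {\<alpha>..\<alpha> + (\<xi> - \<eta>)})) \<le> C * (\<delta> * Q\<^sup>2)"
    using near_points_pinched[OF bnd(1,2) _ \<phi>'] by blast
  have "real (N_count f Q \<psi> {\<eta>..\<xi>}) \<le> C * (\<psi> Q * Q\<^sup>2)" if Q: "1 \<le> Q" for Q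
  proof -
    have "Q powr (- \<phi>') \<le> Q powr (- \<phi>)" using Q unfolding \<phi>'_def by (intro powr_mono) auto
    then have "Q powr (- \<phi>') \<le> \<psi> Q" using \<psi>[OF Q] by linarith
    from cnt[OF h(1) Q this, of \<eta>]
    have "real (card (near_points h Q (\<lambda>_. \<psi> Q) {\<eta>..\<xi>})) \<le> C * (\<psi> Q * Q\<^sup>2)" by simp
    moreover have "near_points f Q \<psi> {\<eta>..\<xi>} = near_points h Q (\<lambda>_. \<psi> Q) {\<eta>..\<xi>}"
      by (rule near_points_cong) (use h(2) in auto)
    ultimately show ?thesis unfolding N_count_def by simp
  qed
  then show ?thesis using C by blast
qed

theorem theorem1p4:
  fixes f f' f'' \<psi> :: "real \<Rightarrow> real" and \<eta> \<xi> \<theta> \<phi> :: real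
  assumes "\<eta> < \<xi>"
    and "\<And>x. x \<in> {\<eta>..\<xi>} \<Longrightarrow> (f has_real_derivative f' x) (at x within {\<eta>..\<xi>})"
    and "\<And>x. x \<in> {\<eta>..\<xi>} \<Longrightarrow> (f' has_real_derivative f'' x) (at x within {\<eta>..\<xi>})"
    and "continuous_on {\<eta>..\<xi>} f''"
    and "\<exists>c>0. \<forall>x\<in>{\<eta>..\<xi>}. c \<le> \<bar>f'' x\<bar>"
    and "0 < \<theta>" and "\<theta> < 1"
    and "f'' \<in> Lip \<theta> {\<eta>..\<xi>}"
    and "approximating_function \<psi>"
    and "\<phi> \<le> (1 + \<theta>) / (3 - \<theta>)"
    and "\<And>Q. 1 \<le> Q \<Longrightarrow> Q powr (- \<phi>) \<le> \<psi> Q"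
  shows "\<exists>C>0. \<forall>Q\<ge>1. real (N_count f Q \<psi> {\<eta>..\<xi>}) \<le> C * (\<psi> Q * Q\<^sup>2)"
proof -
  have "(1 + \<theta>) / (3 - \<theta>) < 1" using assms(7) by (simp add: pos_divide_less_eq)
  then have \<phi>: "\<phi> < 1" using assms(10) by linarith
  obtain c where c: "0 < c" "\<And>x. x \<in> {\<eta>..\<xi>} \<Longrightarrow> c \<le> \<bar>f'' x\<bar>" using assms(5) by blast
  have "compact (f'' ` {\<eta>..\<xi>})" by (rule compact_continuous_image[OF assms(4) compact_Icc])
  from compact_imp_bounded[OF this] obtain b where b: "\<And>x. x \<in> {\<eta>..\<xi>} \<Longrightarrow> \<bar>f'' x\<bar> \<le> b"
    unfolding bounded_iff ball_simps(9) real_norm_def by blast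
  have cb: "c \<le> b" using b[of \<eta>] c(2)[of \<eta>] assms(1) by simp
  have conn: "connected (f'' ` {\<eta>..\<xi>})" by (rule connected_continuous_image[OF assms(4) connected_Icc])
  \<comment> \<open>f'' has no zero and its image is connected, so it has constant sign.\<close>
  consider "\<And>x. x \<in> {\<eta>..\<xi>} \<Longrightarrow> 0 < f'' x" | "\<And>x. x \<in> {\<eta>..\<xi>} \<Longrightarrow> f'' x < 0"
  proof -
    have ne: "f'' x \<noteq> 0" if "x \<in> {\<eta>..\<xi>}" for x using c(1) c(2)[OF that] by auto
    then have nz: "0 \<notin> f'' ` {\<eta>..\<xi>}" by (metis imageE)
    have sgn: "\<not> (f'' x < 0 \<and> 0 < f'' y)" if "x \<in> {\<eta>..\<xi>}" "y \<in> {\<eta>..\<xi>}" for x y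
      using connectedD_interval[OF conn, of "f'' x" "f'' y" 0] that nz by auto
    have \<eta>: "\<eta> \<in> {\<eta>..\<xi>}" using assms(1) by simp
    show thesis
    proof (cases "0 < f'' \<eta>")
      case True
      show thesis by (rule that(1)) (use sgn[OF _ \<eta>] ne True in force)
    next
      case False
      then have "f'' \<eta> < 0" using ne[OF \<eta>] by simp
      then show thesis by (intro that(2)) (use sgn[OF \<eta>] ne in force)
    qed
  qed
  then show ?thesis
  proof cases
    case 1
    show ?thesis
    proof (rule N_count_pos_curvature[OF less_imp_le[OF assms(1)] assms(2,3) c(1) cb _ \<phi> assms(11)])
      show "c \<le> f'' x \<and> f'' x \<le> b" if "x \<in> {\<eta>..\<xi>}" for x
        using 1[OF that] c(2)[OF that] b[OF that] by simp
    qed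
  next
    case 2
    have "\<exists>C>0. \<forall>Q\<ge>1. real (N_count (\<lambda>x. - f x) Q \<psi> {\<eta>..\<xi>}) \<le> C * (\<psi> Q * Q\<^sup>2)"
    proof (rule N_count_pos_curvature[where f' = "\<lambda>x. - f' x" and f'' = "\<lambda>x. - f'' x",
          OF less_imp_le[OF assms(1)] _ _ c(1) cb _ \<phi> assms(11)])
      show "c \<le> - f'' x \<and> - f'' x \<le> b" if "x \<in> {\<eta>..\<xi>}" for x
        using 2[OF that] c(2)[OF that] b[OF that] by simp
    qed (auto intro!: DERIV_minus assms(2,3))
    then show ?thesis unfolding N_count_def card_near_points_uminus .
  qed
qed

end
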